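(* With the setting and notation of the context (Fuchsian group $\Gamma$ uniformizing $X$, quasi-conformal map $f:\mathbb H\to\mathbb D$ intertwining $\Gamma$ and $\tilde\Gamma$), the total cochain $$\Omega=2\pi\sqrt{-1}\,\bigl(\omega,\ \theta_\gamma,\ -\Theta_{\gamma_1,\gamma_2},\ -m_{\gamma_1,\gamma_2,\gamma_3}\bigr)$$ of total degree $3$ in the double complex $C^q(\Gamma,\mathbb Z(3)^p_{\mathcal D}(\mathbb H))$, with $$\omega=\frac{\partial^2 f}{\partial f}\,\partial\mu\,dz\wedge d\bar z+2\mu h\,dz\wedge d\bar z,$$ is a cocycle and hence represents a class in the smooth Deligne cohomology group $H^3_{\mathcal D}(X,\mathbb Z(3))$.
   Context: Notation: $\mathbb Z(p)=(2\pi i)^p\mathbb Z$. $\mathbb Z(3)^\bullet_{\mathcal D}(\mathbb H)$ is the complex $\mathbb Z(3)\hookrightarrow A^0(\mathbb H)\xrightarrow{d}A^1(\mathbb H)\xrightarrow{d}A^2(\mathbb H)$ of smooth complex forms on the upper half-plane $\mathbb H$, with $\mathbb Z(3)$ in degree $0$ and $A^r$ in degree $r+1$, and zero after degree $3$. Setting: $X\cong\Gamma\backslash\mathbb H$ is a compact Riemann surface of genus $g>1$, $\Gamma\subset PSL_2(\mathbb R)$ a finitely generated purely hyperbolic Fuchsian group isomorphic to $\pi_1(X)$. $\mu$ is a smooth Beltrami differential for $\Gamma$ on $\mathbb H$: $\mu\circ\gamma\cdot\overline{\gamma'}/\gamma'=\mu$ for $\gamma\in\Gamma$, $\|\mu\|_\infty<1$.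 $f:\mathbb H\to\mathbb D=f(\mathbb H)$ is a solution of $f_{\bar z}=\mu f_z$, a diffeomorphism onto a quasi-disk $\mathbb D\subset \mathbb P^1$, such that $\tilde\Gamma=f\circ\Gamma\circ f^{-1}\subset PSL_2(\mathbb C)$ is a discrete subgroup; $\gamma\mapsto\tilde\gamma$ denotes the isomorphism with $f\circ\gamma=\tilde\gamma\circ f$. $h$ is a smooth quadratic differential for $\Gamma$: a smooth function on $\mathbb H$ with $h\circ\gamma\cdot(\gamma')^2=h$. $\partial=\partial/\partial z$. Group cochains: $C^q(\Gamma,M)$ with $\Gamma$ acting on forms by pull-back (a right action), and coboundary $$(\delta\phi)_{\gamma_1,\dots,\gamma_q}=\phi_{\gamma_2,\dots,\gamma_q}+\sum_{i=1}^{q-1}(-1)^i\phi_{\gamma_1,\dots,\gamma_i\gamma_{i+1},\dots,\gamma_q}+(-1)^q\gamma_q^*\phi_{\gamma_1,\dots,\gamma_{q-1}}.$$ The total differential on $C^q(\Gamma,\mathbb Z(3)^p_{\mathcal D}(\mathbb H))$ is $D=d+(-1)^p\delta$ ($d$ being the differential of $\mathbb Z(3)^\bullet_{\mathcal D}$); the total cohomology computes the smooth Deligne cohomology $H^\bullet_{\mathcal D}(X,\mathbb Z(3))$, i.e. the hypercohomology of $\mathbb Z(3)_X\hookrightarrow A^0_X\to A^1_X\to A^2_X$. Logarithms: fix branches of $\log\gamma'$ on $\mathbb H$, $\log\tilde\gamma'$ on $\mathbb D$, $\log f_z$ on $\mathbb H$ and set $$c_{\gamma_1,\gamma_2}=\log\gamma_2'-\log(\gamma_1\gamma_2)'+\log\gamma_1'\circ\gamma_2,\quad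 \tilde c_{\gamma_1,\gamma_2}=\log\tilde\gamma_2'-\log(\tilde\gamma_1\tilde\gamma_2)'+\log\tilde\gamma_1'\circ\tilde\gamma_2,$$ $$b_\gamma=\log\tilde\gamma'\circ f-\log\gamma'-\log f_z\circ\gamma+\log f_z,$$ all in $\mathbb Z(1)$. Trivialization of the tame symbol: there exist cochains $\tau_\gamma$ of holomorphic $1$-forms on $\mathbb H$, $\phi_{\gamma_1,\gamma_2}$ of holomorphic functions on $\mathbb H$ and $n_{\gamma_1,\gamma_2,\gamma_3}\in\mathbb Z(2)$ such that $$-\log\gamma_1'\circ\gamma_2\,d\log\gamma_2'=(\delta\tau)_{\gamma_1,\gamma_2}+d\phi_{\gamma_1,\gamma_2},\quad c_{\gamma_1,\gamma_2}\log\gamma_3'=-(\delta\phi)_{\gamma_1,\gamma_2,\gamma_3}+n_{\gamma_1,\gamma_2,\gamma_3},\quad c_{\gamma_1,\gamma_2}c_{\gamma_3,\gamma_4}=(\delta n)_{\gamma_1,\dots,\gamma_4}.$$ Fix such a triple, and fix a triple $\tilde\tau,\tilde\phi,\tilde n$ satisfying the analogous relations for $\tilde\Gamma$ acting on $\mathbb D$ (indexed by $\gamma$'s through $\gamma\mapsto\tilde\gamma$). Components of $\Omega$: $$\theta_\gamma=2\mu\frac{\gamma''}{\gamma'}d\bar z-\bigl(\log(\tilde\gamma'\circ f)+\log\gamma'\bigr)d\log\partial f+\log(\tilde\gamma'\circ f)\,d\log\gamma'-f^*\tilde\tau_\gamma+\tau_\gamma,$$ $$\Theta_{\gamma_1,\gamma_2}=f^*\tilde\phi_{\gamma_1,\gamma_2}-\phi_{\gamma_1,\gamma_2}-(\tilde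 c_{\gamma_1,\gamma_2}+c_{\gamma_1,\gamma_2})\log\partial f-(\log\gamma_1'\circ\gamma_2)\,(\log\tilde\gamma_2'\circ f)+\tilde c_{\gamma_1,\gamma_2}\log(\gamma_1\gamma_2)',$$ $$m_{\gamma_1,\gamma_2,\gamma_3}=\tilde n_{\gamma_1,\gamma_2,\gamma_3}-n_{\gamma_1,\gamma_2,\gamma_3}-(\tilde c_{\gamma_1,\gamma_2}+c_{\gamma_1,\gamma_2})b_{\gamma_3}+c_{\gamma_1,\gamma_2\gamma_3}\tilde c_{\gamma_2,\gamma_3}-c_{\gamma_1\gamma_2,\gamma_3}\tilde c_{\gamma_1,\gamma_2}.$$ *)

theory Defs
  imports "HOL-Analysis.Analysis" "HOL-Homology.Homology"
begin

section \<open>\<open>PSL\<^sub>2\<close> and Fuchsian groups\<close>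

definition SL2C :: "(complex ^ 2 ^ 2) monoid" where
  "SL2C = \<lparr>carrier = {A. det A = 1}, mult = (**), one = mat 1\<rparr>"

type_synonym psl = "(complex ^ 2 ^ 2) set"

definition PSL2C :: "psl monoid" where
  "PSL2C = SL2C Mod {mat 1, - mat 1}"

text \<open>The image of \<open>SL\<^sub>2(\<real>)\<close> in \<open>PSL\<^sub>2(\<complex>)\<close>; it is isomorphic to \<open>PSL\<^sub>2(\<real>)\<close>.\<close>

definition PSL2R :: "psl set" where
  "PSL2R = {g \<in> carrier PSL2C. \<forall>A\<in>g. \<forall>i j. A $ i $ j \<in> \<real>}"

text \<open>The action by fractional linear transformations in the affine coordinate. Both
  representatives \<open>\<plusminus>A\<close> of a class give the same value. At the pole, where the value
  should be \<open>\<infinity>\<close>, division by zero yields \<open>0\<close>; \<open>finite_at\<close> excludes this.\<close>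

definition mob :: "psl \<Rightarrow> complex \<Rightarrow> complex" where
  "mob g z = (let A = (SOME A. A \<in> g) in (A$1$1 * z + A$1$2) / (A$2$1 * z + A$2$2))"

definition finite_at :: "psl \<Rightarrow> complex \<Rightarrow> bool" where
  "finite_at g z \<longleftrightarrow> (\<forall>A\<in>g. A$2$1 * z + A$2$2 \<noteq> 0)"

text \<open>A subgroup of \<open>PSL\<^sub>2(\<complex>)\<close> is discrete iff its full preimage in \<open>SL\<^sub>2(\<complex>)\<close>, which is the
  union of its elements, is a discrete set of matrices.\<close>

definition discrete_subgroup :: "psl set \<Rightarrow> bool" where
  "discrete_subgroup G \<longleftrightarrow> subgroup G PSL2C \<and> discrete (\<Union>G)"

definition fuchsian :: "psl set \<Rightarrow> bool" where
  "fuchsian G \<longleftrightarrow> discrete_subgroup G \<and> G \<subseteq> PSL2R"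

definition purely_hyperbolic :: "psl set \<Rightarrow> bool" where
  "purely_hyperbolic G \<longleftrightarrow> (\<forall>g\<in>G. g \<noteq> \<one>\<^bsub>PSL2C\<^esub> \<longrightarrow> (\<forall>A\<in>g. cmod (trace A) > 2))"

definition finitely_generated :: "psl set \<Rightarrow> bool" where
  "finitely_generated G \<longleftrightarrow> (\<exists>S. finite S \<and> S \<subseteq> carrier PSL2C \<and> G = generate PSL2C S)"

definition UH :: "complex set" where
  "UH = {z. Im z > 0}"


section \<open>The quotient surface\<close>

definition is_quotient_by :: "psl set \<Rightarrow> 'x topology \<Rightarrow> (complex \<Rightarrow> 'x) \<Rightarrow> bool" where
  "is_quotient_by G X p \<longleftrightarrow>
     quotient_map (top_of_set UH) X p \<and>
     (\<forall>z\<in>UH. \<forall>w\<in>UH. p z = p w \<longleftrightarrow> (\<exists>\<gamma>\<in>G. w = mob \<gamma> z))"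

text \<open>The genus of a closed orientable surface, read off from \<open>H\<^sub>1(X;\<int>) \<cong> \<int>\<^sup>2\<^sup>g\<close>.\<close>

definition has_genus :: "'x topology \<Rightarrow> nat \<Rightarrow> bool" where
  "has_genus X g \<longleftrightarrow> homology_group 1 X \<cong> free_Abelian_group {..<2 * g}"

definition loops :: "'x topology \<Rightarrow> 'x \<Rightarrow> (real \<Rightarrow> 'x) set" where
  "loops X x = {g. pathin X g \<and> g 0 = x \<and> g 1 = x}"

definition loop_homotopy :: "'x topology \<Rightarrow> 'x \<Rightarrow> ((real \<Rightarrow> 'x) \<times> (real \<Rightarrow> 'x)) set" where
  "loop_homotopy X x = {(g, h). g \<in> loops X x \<and> h \<in> loops X x \<and>
     homotopic_with (\<lambda>k. k 0 = x \<and> k 1 = x) (top_of_set {0..1}) X g h}"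

definition loop_join :: "(real \<Rightarrow> 'x) \<Rightarrow> (real \<Rightarrow> 'x) \<Rightarrow> real \<Rightarrow> 'x" where
  "loop_join g h t = (if t \<le> 1/2 then g (2 * t) else h (2 * t - 1))"

definition fundamental_group :: "'x topology \<Rightarrow> 'x \<Rightarrow> (real \<Rightarrow> 'x) set monoid" where
  "fundamental_group X x =
     \<lparr>carrier = loops X x // loop_homotopy X x,
      mult = (\<lambda>C C'. \<Union>g\<in>C. \<Union>h\<in>C'. loop_homotopy X x `` {loop_join g h}),
      one = loop_homotopy X x `` {\<lambda>_. x}\<rparr>"


section \<open>Wirtinger derivatives and smooth functions\<close>

definition wirt :: "(complex \<Rightarrow> complex) \<Rightarrow> complex \<Rightarrow> complex" where
  "wirt u z = (frechet_derivative u (at z) 1 - \<i> * frechet_derivative u (at z) \<i>) / 2"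

definition wirtbar :: "(complex \<Rightarrow> complex) \<Rightarrow> complex \<Rightarrow> complex" where
  "wirtbar u z = (frechet_derivative u (at z) 1 + \<i> * frechet_derivative u (at z) \<i>) / 2"

text \<open>Class \<open>C\<^sup>k\<close> on an open set in the real sense; the two Wirtinger derivatives span the
  same space as the two real partial derivatives.\<close>

primrec Ck_on :: "nat \<Rightarrow> complex set \<Rightarrow> (complex \<Rightarrow> complex) \<Rightarrow> bool" where
  "Ck_on 0 S u \<longleftrightarrow> continuous_on S u"
| "Ck_on (Suc k) S u \<longleftrightarrow>
     u differentiable_on S \<and> Ck_on k S (wirt u) \<and> Ck_on k S (wirtbar u)"

definition smooth_on :: "complex set \<Rightarrow> (complex \<Rightarrow> complex) \<Rightarrow> bool" where
  "smooth_on S u \<longleftrightarrow> (\<forall>k. Ck_on k S u)"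

definition diffeo_onto :: "complex set \<Rightarrow> complex set \<Rightarrow> (complex \<Rightarrow> complex) \<Rightarrow> bool" where
  "diffeo_onto S T u \<longleftrightarrow> bij_betw u S T \<and> smooth_on S u \<and> open T \<and> smooth_on T (inv_into S u)"


section \<open>Quasi-disks\<close>

text \<open>The projective line is modelled as the unit sphere of \<open>\<complex> \<times> \<real>\<close>, with \<open>\<complex>\<close> embedded by inverse
  stereographic projection from \<open>\<infinity> = (0, 1)\<close>.\<close>

definition stereo :: "complex \<Rightarrow> complex \<times> real" where
  "stereo z = (of_real (2 / ((cmod z)\<^sup>2 + 1)) * z, ((cmod z)\<^sup>2 - 1) / ((cmod z)\<^sup>2 + 1))"

text \<open>Metric definition of quasi-conformality: the linear dilatation
  \<open>limsup\<^bsub>r\<rightarrow>0\<^esub> (max\<^bsub>|y-x|=r\<^esub> |g y - g x|) / (min\<^bsub>|y-x|=r\<^esub> |g y - g x|)\<close> is uniformly bounded in \<open>x\<close>.\<close>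

definition quasiconformal_sphere :: "(complex \<times> real \<Rightarrow> complex \<times> real) \<Rightarrow> bool" where
  "quasiconformal_sphere g \<longleftrightarrow>
     (\<exists>g'. homeomorphism (sphere 0 1) (sphere 0 1) g g') \<and>
     (\<exists>K. \<forall>x\<in>sphere 0 1. \<forall>\<^sub>F r in at_right 0.
        \<forall>y\<in>sphere 0 1. \<forall>y'\<in>sphere 0 1. dist x y = r \<longrightarrow> dist x y' = r \<longrightarrow>
          dist (g x) (g y) \<le> K * dist (g x) (g y'))"

definition quasi_disk :: "complex set \<Rightarrow> bool" where
  "quasi_disk D \<longleftrightarrow> (\<exists>g. quasiconformal_sphere g \<and> stereo ` D = g ` stereo ` UH)"


section \<open>Automorphic data\<close>

text \<open>The bound \<open>k\<close> expresses \<open>\<parallel>\<mu>\<parallel>\<^sub>\<infinity> < 1\<close>; for continuous \<open>\<mu>\<close> the essential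
  supremum is the supremum.\<close>

definition beltrami_differential :: "psl set \<Rightarrow> (complex \<Rightarrow> complex) \<Rightarrow> bool" where
  "beltrami_differential G \<mu> \<longleftrightarrow>
     smooth_on UH \<mu> \<and>
     (\<forall>\<gamma>\<in>G. \<forall>z\<in>UH. \<mu> (mob \<gamma> z) * cnj (deriv (mob \<gamma>) z) / deriv (mob \<gamma>) z = \<mu> z) \<and>
     (\<exists>k<1. \<forall>z\<in>UH. cmod (\<mu> z) \<le> k)"

definition quadratic_differential :: "psl set \<Rightarrow> (complex \<Rightarrow> complex) \<Rightarrow> bool" where
  "quadratic_differential G h \<longleftrightarrow>
     smooth_on UH h \<and> (\<forall>\<gamma>\<in>G. \<forall>z\<in>UH. h (mob \<gamma> z) * (deriv (mob \<gamma>) z)\<^sup>2 = h z)"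

definition log_branch :: "complex set \<Rightarrow> (complex \<Rightarrow> complex) \<Rightarrow> (complex \<Rightarrow> complex) \<Rightarrow> bool" where
  "log_branch S u l \<longleftrightarrow> continuous_on S l \<and> (\<forall>z\<in>S. exp (l z) = u z)"


section \<open>Differential forms\<close>

text \<open>A form of degree \<open>r\<close> is evaluated at a point on a list of \<open>r\<close> tangent vectors. Values at
  points outside the domain and on lists of other lengths are irrelevant, so forms of degree \<open>r\<close>
  on \<open>S\<close> are compared by \<open>form_eq S r\<close>.\<close>

type_synonym form = "complex \<Rightarrow> complex list \<Rightarrow> complex"

definition form_eq :: "complex set \<Rightarrow> nat \<Rightarrow> form \<Rightarrow> form \<Rightarrow> bool" where
  "form_eq S r \<alpha> \<beta> \<longleftrightarrow> (\<forall>z\<in>S. \<forall>vs. length vs = r \<longrightarrow> \<alpha> z vs = \<beta> z vs)"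

definition zero_form :: form where
  "zero_form = (\<lambda>z vs. 0)"

definition smooth_forms :: "complex set \<Rightarrow> nat \<Rightarrow> form set" where
  "smooth_forms S r = {\<alpha>.
     (\<forall>vs. length vs = r \<longrightarrow> smooth_on S (\<lambda>z. \<alpha> z vs)) \<and>
     (\<forall>z\<in>S. \<forall>vs. length vs = r \<longrightarrow> (\<forall>i<r. linear (\<lambda>v. \<alpha> z (vs[i := v])))) \<and>
     (\<forall>z\<in>S. \<forall>vs i j. length vs = r \<and> i < j \<and> j < r \<and> vs ! i = vs ! j \<longrightarrow> \<alpha> z vs = 0)}"

definition ext_d :: "form \<Rightarrow> form" where
  "ext_d \<alpha> z vs = (\<Sum>i<length vs. (-1) ^ i *
     frechet_derivative (\<lambda>x. \<alpha> x (take i vs @ drop (Suc i) vs)) (at z) (vs ! i))"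

definition pullback :: "(complex \<Rightarrow> complex) \<Rightarrow> form \<Rightarrow> form" where
  "pullback g \<alpha> z vs = \<alpha> (g z) (map (frechet_derivative g (at z)) vs)"

definition fn_form :: "(complex \<Rightarrow> complex) \<Rightarrow> form" where
  "fn_form u z vs = u z"

text \<open>The holomorphic form \<open>t dz\<close>.\<close>

definition dz_form :: "(complex \<Rightarrow> complex) \<Rightarrow> form" where
  "dz_form t z vs = t z * vs ! 0"

definition dzbar :: form where
  "dzbar z vs = cnj (vs ! 0)"

definition dz_wedge_dzbar :: form where
  "dz_wedge_dzbar z vs = vs ! 0 * cnj (vs ! 1) - vs ! 1 * cnj (vs ! 0)"


section \<open>Group cochains\<close>

definition merge_at :: "nat \<Rightarrow> psl list \<Rightarrow> psl list" where
  "merge_at i gs = take (i - 1) gs @ [gs ! (i - 1) \<otimes>\<^bsub>PSL2C\<^esub> gs ! i] @ drop (i + 1) gs"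

text \<open>The coboundary of a \<open>(q-1)\<close>-cochain, where \<open>q = length gs\<close> and \<open>\<gamma>\<close> acts on forms by pull-back
  along \<open>T \<gamma>\<close>. There are no cochains of degree \<open>-1\<close>, hence the value zero for \<open>q = 0\<close>.\<close>

definition cobd :: "(psl \<Rightarrow> complex \<Rightarrow> complex) \<Rightarrow> (psl list \<Rightarrow> form) \<Rightarrow> psl list \<Rightarrow> form" where
  "cobd T \<phi> gs z vs =
     (if gs = [] then 0
      else \<phi> (tl gs) z vs
           + (\<Sum>i = 1..length gs - 1. (-1) ^ i * \<phi> (merge_at i gs) z vs)
           + (-1) ^ length gs * pullback (T (last gs)) (\<phi> (butlast gs)) z vs)"


section \<open>The smooth Deligne double complex\<close>

definition ZZ :: "nat \<Rightarrow> complex set" where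
  "ZZ p = {(2 * of_real pi * \<i>) ^ p * of_int k | k. True}"

text \<open>The term of degree \<open>p\<close> of \<open>\<int>(3) \<hookrightarrow> A\<^sup>0 \<rightarrow> A\<^sup>1 \<rightarrow> A\<^sup>2\<close> on the upper half-plane. An integer
  \<open>k \<in> \<int>(3)\<close> is stored as the constant function \<open>k\<close>, so that the first differential is the
  identity on representatives. In degree \<open>p\<close> forms have degree \<open>p - 1\<close>, with truncated
  subtraction for \<open>p = 0\<close>.\<close>

definition deligne_term :: "nat \<Rightarrow> form set" where
  "deligne_term p =
     (if p = 0 then {\<alpha>. \<exists>k\<in>ZZ 3. form_eq UH 0 \<alpha> (fn_form (\<lambda>_. k))}
      else if p \<le> 3 then smooth_forms UH (p - 1)
      else {\<alpha>. form_eq UH (p - 1) \<alpha> zero_form})"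

definition deligne_d :: "nat \<Rightarrow> form \<Rightarrow> form" where
  "deligne_d p \<alpha> = (if p = 0 then \<alpha> else if p \<le> 2 then ext_d \<alpha> else zero_form)"

text \<open>A total cochain of degree \<open>n\<close> has as its value at \<open>p\<close> the component in
  \<open>C\<^sup>q(\<Gamma>, \<int>(3)\<^sup>p)\<close> with \<open>p + q = n\<close>.\<close>

type_synonym tot_cochain = "nat \<Rightarrow> psl list \<Rightarrow> form"

definition tot_cochains :: "psl set \<Rightarrow> nat \<Rightarrow> tot_cochain set" where
  "tot_cochains G n = {\<Omega>. \<forall>p gs. p + length gs = n \<and> gs \<in> lists G \<longrightarrow> \<Omega> p gs \<in> deligne_term p}"

definition tot_eq :: "psl set \<Rightarrow> nat \<Rightarrow> tot_cochain \<Rightarrow> tot_cochain \<Rightarrow> bool" where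
  "tot_eq G n \<Omega> \<Omega>' \<longleftrightarrow>
     (\<forall>p gs. p + length gs = n \<and> gs \<in> lists G \<longrightarrow> form_eq UH (p - 1) (\<Omega> p gs) (\<Omega>' p gs))"

definition tot_zero :: tot_cochain where
  "tot_zero = (\<lambda>p gs. zero_form)"

text \<open>\<open>D = d + (-1)\<^sup>p \<delta>\<close>: the component of \<open>D \<Omega>\<close> at \<open>p\<close> collects \<open>d\<close> of the component at
  \<open>p - 1\<close> and \<open>(-1)\<^sup>p \<delta>\<close> of the component at \<open>p\<close>.\<close>

definition tot_D :: "tot_cochain \<Rightarrow> tot_cochain" where
  "tot_D \<Omega> p gs z vs =
     (if p = 0 then 0 else deligne_d (p - 1) (\<Omega> (p - 1) gs) z vs)
     + (-1) ^ p * cobd mob (\<Omega> p) gs z vs"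

definition deligne_cocycles :: "psl set \<Rightarrow> nat \<Rightarrow> tot_cochain set" where
  "deligne_cocycles G n = {\<Omega> \<in> tot_cochains G n. tot_eq G (n + 1) (tot_D \<Omega>) tot_zero}"

definition deligne_coboundaries :: "psl set \<Rightarrow> nat \<Rightarrow> tot_cochain set" where
  "deligne_coboundaries G n = {\<Omega> \<in> tot_cochains G n.
     tot_eq G n \<Omega> tot_zero \<or>
     (\<exists>k \<Psi>. n = Suc k \<and> \<Psi> \<in> tot_cochains G k \<and> tot_eq G n \<Omega> (tot_D \<Psi>))}"

definition deligne_cocycle_group :: "psl set \<Rightarrow> nat \<Rightarrow> tot_cochain monoid" where
  "deligne_cocycle_group G n =
     \<lparr>carrier = deligne_cocycles G n,
      mult = (\<lambda>\<Omega> \<Omega>' p gs z vs. \<Omega> p gs z vs + \<Omega>' p gs z vs),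
      one = tot_zero\<rparr>"

text \<open>The smooth Deligne cohomology \<open>H\<^sup>n(X, \<int>(3))\<close> of the quotient \<open>X\<close> of \<open>UH\<close> by \<open>\<Gamma>\<close>, as the hypercohomology of
  \<open>\<int>(3) \<hookrightarrow> A\<^sup>0 \<rightarrow> A\<^sup>1 \<rightarrow> A\<^sup>2\<close> computed by the covering \<open>UH \<rightarrow> X\<close>, whose Cech complex is the
  complex of group cochains. The coboundaries contain every cochain that vanishes where it
  matters, so the irrelevant values of representatives disappear in the quotient.\<close>

definition deligne_cohomology :: "psl set \<Rightarrow> nat \<Rightarrow> tot_cochain set monoid" where
  "deligne_cohomology G n = deligne_cocycle_group G n Mod deligne_coboundaries G n"


section \<open>Logarithmic cocycles and the trivialization of the tame symbol\<close>

text \<open>\<open>l \<gamma>\<close> is a branch on \<open>S\<close> of the logarithm of the derivative of \<open>T \<gamma>\<close>; the expression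
  is constant on connected \<open>S\<close>.\<close>

definition log_cocycle ::
  "(psl \<Rightarrow> complex \<Rightarrow> complex) \<Rightarrow> complex set \<Rightarrow> (psl \<Rightarrow> complex \<Rightarrow> complex) \<Rightarrow> psl \<Rightarrow> psl \<Rightarrow> complex" where
  "log_cocycle T S l g1 g2 =
     (THE k. \<forall>z\<in>S. k = l g2 z - l (g1 \<otimes>\<^bsub>PSL2C\<^esub> g2) z + l g1 (T g2 z))"

definition b_const ::
  "(complex \<Rightarrow> complex) \<Rightarrow> (psl \<Rightarrow> complex \<Rightarrow> complex) \<Rightarrow> (psl \<Rightarrow> complex \<Rightarrow> complex) \<Rightarrow>
   (complex \<Rightarrow> complex) \<Rightarrow> psl \<Rightarrow> complex" where
  "b_const f l lt lf g =
     (THE k. \<forall>z\<in>UH. k = lt g (f z) - l g z - lf (mob g z) + lf z)"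

text \<open>The holomorphic \<open>1\<close>-form \<open>\<tau>\<^sub>\<gamma>\<close> is given by its coefficient with respect to \<open>dz\<close>.\<close>

definition tame_trivialization ::
  "psl set \<Rightarrow> (psl \<Rightarrow> complex \<Rightarrow> complex) \<Rightarrow> complex set \<Rightarrow> (psl \<Rightarrow> complex \<Rightarrow> complex) \<Rightarrow>
   (psl list \<Rightarrow> complex \<Rightarrow> complex) \<Rightarrow> (psl list \<Rightarrow> complex \<Rightarrow> complex) \<Rightarrow> (psl list \<Rightarrow> complex) \<Rightarrow> bool" where
  "tame_trivialization G T S l \<tau> \<phi> n \<longleftrightarrow>
     (\<forall>g1\<in>G. \<tau> [g1] holomorphic_on S) \<and>
     (\<forall>g1\<in>G. \<forall>g2\<in>G. \<phi> [g1, g2] holomorphic_on S) \<and>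
     (\<forall>g1\<in>G. \<forall>g2\<in>G. \<forall>g3\<in>G. n [g1, g2, g3] \<in> ZZ 2) \<and>
     (\<forall>g1\<in>G. \<forall>g2\<in>G. form_eq S 1
        (\<lambda>z vs. - l g1 (T g2 z) * ext_d (fn_form (l g2)) z vs)
        (\<lambda>z vs. cobd T (\<lambda>gs. dz_form (\<tau> gs)) [g1, g2] z vs
                + ext_d (fn_form (\<phi> [g1, g2])) z vs)) \<and>
     (\<forall>g1\<in>G. \<forall>g2\<in>G. \<forall>g3\<in>G. form_eq S 0
        (\<lambda>z vs. log_cocycle T S l g1 g2 * l g3 z)
        (\<lambda>z vs. - cobd T (\<lambda>gs. fn_form (\<phi> gs)) [g1, g2, g3] z vs + n [g1, g2, g3])) \<and>
     (\<forall>g1\<in>G. \<forall>g2\<in>G. \<forall>g3\<in>G. \<forall>g4\<in>G. form_eq S 0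
        (\<lambda>z vs. log_cocycle T S l g1 g2 * log_cocycle T S l g3 g4)
        (cobd T (\<lambda>gs. fn_form (\<lambda>_. n gs)) [g1, g2, g3, g4]))"


section \<open>The total cochain\<close>

text \<open>In the following \<open>l \<gamma>\<close>, \<open>lt \<gamma>\<close> and \<open>lf\<close> stand for branches of \<open>log \<gamma>'\<close>, \<open>log \<gamma>\<^bsup>~\<^esup>'\<close> and
  \<open>log f\<^sub>z\<close>, and \<open>c\<close>, \<open>ct\<close> and \<open>b\<close> for the constants obtained from them.\<close>

definition omega_form :: "(complex \<Rightarrow> complex) \<Rightarrow> (complex \<Rightarrow> complex) \<Rightarrow> (complex \<Rightarrow> complex) \<Rightarrow> form" where
  "omega_form \<mu> f h z vs =
     wirt (wirt f) z / wirt f z * wirt \<mu> z * dz_wedge_dzbar z vs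
     + 2 * \<mu> z * h z * dz_wedge_dzbar z vs"

definition theta_form ::
  "(complex \<Rightarrow> complex) \<Rightarrow> (complex \<Rightarrow> complex) \<Rightarrow>
   (psl \<Rightarrow> complex \<Rightarrow> complex) \<Rightarrow> (psl \<Rightarrow> complex \<Rightarrow> complex) \<Rightarrow> (complex \<Rightarrow> complex) \<Rightarrow>
   (psl list \<Rightarrow> complex \<Rightarrow> complex) \<Rightarrow> (psl list \<Rightarrow> complex \<Rightarrow> complex) \<Rightarrow> psl \<Rightarrow> form" where
  "theta_form \<mu> f l lt lf \<tau> \<tau>t g z vs =
     2 * \<mu> z * (deriv (deriv (mob g)) z / deriv (mob g) z) * dzbar z vs
     - (lt g (f z) + l g z) * ext_d (fn_form lf) z vs
     + lt g (f z) * ext_d (fn_form (l g)) z vs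
     - pullback f (dz_form (\<tau>t [g])) z vs
     + dz_form (\<tau> [g]) z vs"

definition Theta_form ::
  "(complex \<Rightarrow> complex) \<Rightarrow>
   (psl \<Rightarrow> complex \<Rightarrow> complex) \<Rightarrow> (psl \<Rightarrow> complex \<Rightarrow> complex) \<Rightarrow> (complex \<Rightarrow> complex) \<Rightarrow>
   (psl \<Rightarrow> psl \<Rightarrow> complex) \<Rightarrow> (psl \<Rightarrow> psl \<Rightarrow> complex) \<Rightarrow>
   (psl list \<Rightarrow> complex \<Rightarrow> complex) \<Rightarrow> (psl list \<Rightarrow> complex \<Rightarrow> complex) \<Rightarrow> psl \<Rightarrow> psl \<Rightarrow> form" where
  "Theta_form f l lt lf c ct \<phi> \<phi>t g1 g2 z vs =
     pullback f (fn_form (\<phi>t [g1, g2])) z vs - \<phi> [g1, g2] z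
     - (ct g1 g2 + c g1 g2) * lf z
     - l g1 (mob g2 z) * lt g2 (f z)
     + ct g1 g2 * l (g1 \<otimes>\<^bsub>PSL2C\<^esub> g2) z"

definition m_const ::
  "(psl \<Rightarrow> psl \<Rightarrow> complex) \<Rightarrow> (psl \<Rightarrow> psl \<Rightarrow> complex) \<Rightarrow> (psl \<Rightarrow> complex) \<Rightarrow>
   (psl list \<Rightarrow> complex) \<Rightarrow> (psl list \<Rightarrow> complex) \<Rightarrow> psl \<Rightarrow> psl \<Rightarrow> psl \<Rightarrow> complex" where
  "m_const c ct b n nt g1 g2 g3 =
     nt [g1, g2, g3] - n [g1, g2, g3] - (ct g1 g2 + c g1 g2) * b g3
     + c g1 (g2 \<otimes>\<^bsub>PSL2C\<^esub> g3) * ct g2 g3 - c (g1 \<otimes>\<^bsub>PSL2C\<^esub> g2) g3 * ct g1 g2"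

definition Omega_cochain ::
  "form \<Rightarrow> (psl \<Rightarrow> form) \<Rightarrow> (psl \<Rightarrow> psl \<Rightarrow> form) \<Rightarrow> (psl \<Rightarrow> psl \<Rightarrow> psl \<Rightarrow> complex) \<Rightarrow> tot_cochain" where
  "Omega_cochain \<omega> \<theta> \<Theta> m p gs z vs = 2 * of_real pi * \<i> *
     (if p = 3 then \<omega> z vs
      else if p = 2 then \<theta> (gs ! 0) z vs
      else if p = 1 then - \<Theta> (gs ! 0) (gs ! 1) z vs
      else if p = 0 then - m (gs ! 0) (gs ! 1) (gs ! 2)
      else 0)"

end

theory Submission
  imports Defs "HOL-Complex_Analysis.Cauchy_Integral_Formula"
begin

text \<open>The total differential splits by degree, and \<open>D \<Omega> = 0\<close> amounts to the four identities
  \<open>d \<theta> = \<delta> \<omega>\<close>, \<open>d \<Theta> = \<delta> \<theta>\<close>, \<open>\<delta> \<Theta> = m\<close> and \<open>\<delta> m = 0\<close>. They rest on one relation.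
  Differentiating \<open>f \<circ> \<gamma> = \<gamma>~ \<circ> f\<close> with respect to \<open>z\<close> and taking logarithms gives
  \<open>log \<gamma>~' \<circ> f = log \<gamma>' + log f\<^sub>z \<circ> \<gamma> - log f\<^sub>z + b\<^sub>\<gamma>\<close> with a constant \<open>b\<^sub>\<gamma>\<close> (lemma \<open>b_eq\<close>), which allows
  the logarithms of the derivatives in \<open>\<Gamma>\<close> and in its image to be compared.

  In \<open>\<delta> \<Theta> = m\<close> (\<open>delta_Theta\<close>) the trivializations of the two tame symbols replace \<open>\<delta> \<phi>\<close> and its
  counterpart by products of a constant and a logarithm, and all non-constant terms cancel by the
  relation above. Then \<open>\<delta> m = 0\<close> holds because \<open>m\<close> is a coboundary (\<open>delta_m\<close>). The identity
  \<open>d \<Theta> = \<delta> \<theta>\<close> (\<open>d_Theta\<close>) uses the differential of the same relation, the first-order part of the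
  trivializations, and the transformation law of \<open>\<mu>\<close>.

  The identity \<open>d \<theta> = \<omega> - \<gamma>\<^sup>* \<omega>\<close> (\<open>d_theta\<close>) is where the analysis of \<open>f\<close> enters. Differentiating the
  Beltrami equation shows that the conjugate derivative of \<open>log f\<^sub>z\<close> is
  \<open>\<partial> \<mu> + \<mu> \<partial> log f\<^sub>z\<close> (\<open>wirt_lf\<close>), and differentiating the transformation law of \<open>\<mu>\<close> gives
  that of \<open>\<partial> \<mu>\<close> (\<open>wirt_mu_mob\<close>). After these substitutions the two sides differ by a multiple of the
  Schwarzian derivative of \<open>\<gamma>\<close>, which is zero for a fractional linear transformation
  (\<open>mob_schwarzian\<close>). The summand \<open>2 \<mu> h\<close> is \<open>\<Gamma>\<close>-invariant as a two-form.

  The rest is calculus: closure properties of the smooth functions as defined by iterated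
  Wirtinger derivatives, the symmetry of second derivatives, and the fact that a continuous logarithm of a
  holomorphic or smooth function is again holomorphic or smooth.\<close>

section \<open>Wirtinger calculus\<close>

text \<open>The real differential of a complex function is \<open>p dz + q d\<zeta>\<close> with \<open>\<zeta>\<close> the conjugate
  coordinate. Recording both coefficients in one predicate lets derivatives of composite
  expressions be assembled by rules, as for one-variable derivatives; holomorphic functions are
  those with \<open>q = 0\<close>, and they may be composed on either side.\<close>

definition has_wirt :: "(complex \<Rightarrow> complex) \<Rightarrow> complex \<Rightarrow> complex \<Rightarrow> complex \<Rightarrow> bool" where
  "has_wirt u p q z \<longleftrightarrow> (u has_derivative (\<lambda>v. p * v + q * cnj v)) (at z)"

lemma has_wirt_frechet: "has_wirt u p q z \<Longrightarrow> frechet_derivative u (at z) = (\<lambda>v. p * v + q * cnj v)"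
  unfolding has_wirt_def by (metis frechet_derivative_at)

lemma has_wirt_imp_wirt: "has_wirt u p q z \<Longrightarrow> wirt u z = p"
  by (simp add: wirt_def has_wirt_frechet algebra_simps)

lemma has_wirt_imp_wirtbar: "has_wirt u p q z \<Longrightarrow> wirtbar u z = q"
  by (simp add: wirtbar_def has_wirt_frechet algebra_simps)

lemma has_wirt_differentiable: "has_wirt u p q z \<Longrightarrow> u differentiable (at z)"
  unfolding has_wirt_def differentiable_def by blast

lemma has_wirt_wirt_wirtbar:
  assumes "u differentiable (at z)"
  shows "has_wirt u (wirt u z) (wirtbar u z) z"
proof -
  let ?D = "frechet_derivative u (at z)"
  have D: "(u has_derivative ?D) (at z)"
    using assms frechet_derivative_works by blast
  then have lin: "linear ?D" by (rule has_derivative_linear)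
  have "?D v = wirt u z * v + wirtbar u z * cnj v" for v
  proof -
    have "?D v = ?D (Re v *\<^sub>R 1 + Im v *\<^sub>R \<i>)"
      by (rule arg_cong) (simp add: complex_eq_iff)
    also have "\<dots> = Re v *\<^sub>R ?D 1 + Im v *\<^sub>R ?D \<i>"
      using lin by (simp add: linear_add linear_scale)
    also have "\<dots> = wirt u z * v + wirtbar u z * cnj v"
      unfolding wirt_def wirtbar_def
      by (subst (3 4) complex_eq) (simp add: scaleR_conv_of_real field_simps complex_eq_iff)
    finally show ?thesis .
  qed
  then have "?D = (\<lambda>v. wirt u z * v + wirtbar u z * cnj v)" by blast
  with D show ?thesis by (simp add: has_wirt_def)
qed

lemma has_wirt_holomorphic_iff: "has_wirt u p 0 z \<longleftrightarrow> (u has_field_derivative p) (at z)"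
  by (simp add: has_wirt_def has_field_derivative_def)

lemma has_wirt_const: "has_wirt (\<lambda>_. k) 0 0 z"
  by (simp add: has_wirt_def)

lemma has_wirt_add:
  "has_wirt u p q z \<Longrightarrow> has_wirt v p' q' z \<Longrightarrow> has_wirt (\<lambda>x. u x + v x) (p + p') (q + q') z"
  unfolding has_wirt_def
  by (drule (1) has_derivative_add) (simp add: algebra_simps)

lemma has_wirt_diff:
  "has_wirt u p q z \<Longrightarrow> has_wirt v p' q' z \<Longrightarrow> has_wirt (\<lambda>x. u x - v x) (p - p') (q - q') z"
  unfolding has_wirt_def
  by (drule (1) has_derivative_diff) (simp add: algebra_simps)

lemma has_wirt_mult:
  "has_wirt u p q z \<Longrightarrow> has_wirt v p' q' z \<Longrightarrow>
    has_wirt (\<lambda>x. u x * v x) (p * v z + u z * p') (q * v z + u z * q') z"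
  unfolding has_wirt_def
  by (drule (1) has_derivative_mult) (simp add: algebra_simps)

lemmas has_wirt_intros = has_wirt_const has_wirt_add has_wirt_diff has_wirt_mult

lemma has_wirt_holomorphic_comp:
  assumes "has_wirt u p q z" and "(g has_field_derivative d) (at (u z))"
  shows "has_wirt (\<lambda>x. g (u x)) (d * p) (d * q) z"
  using has_derivative_compose[OF assms(1)[unfolded has_wirt_def] assms(2)[unfolded has_field_derivative_def]]
  by (simp add: has_wirt_def algebra_simps)

lemma has_wirt_comp_holomorphic:
  assumes "(g has_field_derivative d) (at z)" and "has_wirt u p q (g z)"
  shows "has_wirt (\<lambda>x. u (g x)) (p * d) (q * cnj d) z"
  using has_derivative_compose[OF assms(1)[unfolded has_field_derivative_def] assms(2)[unfolded has_wirt_def]]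
  by (simp add: has_wirt_def algebra_simps)

lemma has_wirt_cong:
  assumes "open S" "z \<in> S" "\<And>x. x \<in> S \<Longrightarrow> u x = v x" "has_wirt u p q z"
  shows "has_wirt v p q z"
  using assms unfolding has_wirt_def
  by (meson has_derivative_transform_within_open)

lemma has_wirt_unique: "has_wirt u p q z \<Longrightarrow> has_wirt u p' q' z \<Longrightarrow> p = p' \<and> q = q'"
  using has_wirt_imp_wirt has_wirt_imp_wirtbar by metis

lemma holomorphic_frechet:
  assumes "open S" "u holomorphic_on S" "z \<in> S"
  shows "frechet_derivative u (at z) = (\<lambda>v. deriv u z * v)"
  using holomorphic_derivI[OF assms(2,1,3)] has_wirt_frechet[of u "deriv u z" 0 z]
  by (simp add: has_wirt_holomorphic_iff)

section \<open>Symmetry of second derivatives\<close>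

text \<open>Both mixed derivatives are the limit of the second
  difference over the parallelogram spanned by \<open>t a\<close> and \<open>t b\<close>, divided by \<open>t\<^sup>2\<close>, and this second
  difference is symmetric in \<open>a\<close> and \<open>b\<close>. Differentiability of the first derivatives at the
  single point \<open>z\<close> suffices, by the mean value inequality along one side.\<close>

lemma second_difference_approx:
  fixes u :: "'a::real_normed_vector \<Rightarrow> 'b::real_normed_vector"
  assumes S: "open S" "z \<in> S" and u: "\<And>x. x \<in> S \<Longrightarrow> (u has_derivative D x) (at x)"
    and Da: "((\<lambda>x. D x a) has_derivative Da) (at z)" and "e > 0"
  shows "\<exists>d>0. \<forall>t. 0 < t \<and> t < d \<longrightarrow>
    norm (u (z + t *\<^sub>R a + t *\<^sub>R b) - u (z + t *\<^sub>R a) - u (z + t *\<^sub>R b) + u z - t\<^sup>2 *\<^sub>R Da b)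
      \<le> 2 * e * t\<^sup>2 * (norm a + norm b)"
proof -
  obtain r where r: "r > 0" "ball z r \<subseteq> S"
    using S open_contains_ball by blast
  obtain d0 where d0: "d0 > 0"
    "\<And>x. norm (x - z) < d0 \<Longrightarrow> norm (D x a - D z a - Da (x - z)) \<le> e * norm (x - z)"
    using Da \<open>e > 0\<close> unfolding has_derivative_at_alt by blast
  have linDa: "linear Da" using Da by (rule has_derivative_linear)
  define K where "K = norm a + norm b"
  define d where "d = min r d0 / (K + 1)"
  have K0: "K \<ge> 0" by (simp add: K_def)
  have dpos: "d > 0" unfolding d_def using r d0 K0 by (intro divide_pos_pos) auto
  show ?thesis
  proof (intro exI[of _ d] conjI allI impI)
    show "d > 0" by (rule dpos)
    fix t :: real assume t: "0 < t \<and> t < d"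
    have small: "t * K < min r d0"
    proof -
      have "t * K \<le> t * (K + 1)" using t by (simp add: algebra_simps)
      also have "\<dots> < d * (K + 1)" using t K0 by (intro mult_strict_right_mono) auto
      also have "\<dots> = min r d0" using K0 by (simp add: d_def)
      finally show ?thesis .
    qed
    have nrm: "norm (s *\<^sub>R a + s' *\<^sub>R b) \<le> t * K" if "0 \<le> s" "s \<le> t" "0 \<le> s'" "s' \<le> t" for s s'
    proof -
      have "norm (s *\<^sub>R a + s' *\<^sub>R b) \<le> s * norm a + s' * norm b"
        using norm_triangle_ineq[of "s *\<^sub>R a" "s' *\<^sub>R b"] that by simp
      also have "\<dots> \<le> t * norm a + t * norm b"
        using that by (intro add_mono mult_right_mono) auto
      finally show ?thesis by (simp add: K_def algebra_simps)
    qed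
    have inS: "z + (s *\<^sub>R a + s' *\<^sub>R b) \<in> S" if "0 \<le> s" "s \<le> t" "0 \<le> s'" "s' \<le> t" for s s'
    proof -
      have "dist (z + (s *\<^sub>R a + s' *\<^sub>R b)) z = norm (s *\<^sub>R a + s' *\<^sub>R b)"
        by (simp add: dist_norm)
      then have "z + (s *\<^sub>R a + s' *\<^sub>R b) \<in> ball z r"
        using nrm[OF that] small by (simp add: dist_commute)
      then show ?thesis using r(2) by blast
    qed
    \<comment> \<open>Along the side \<open>a\<close>, the second difference minus its expected value is \<open>H t - H 0\<close>; the
      differentiability of \<open>D x a\<close> at \<open>z\<close> makes the derivative of \<open>H\<close> of size \<open>e t\<close>.\<close>
    define H where "H s = u (z + (s *\<^sub>R a + t *\<^sub>R b)) - u (z + (s *\<^sub>R a + 0 *\<^sub>R b)) - s *\<^sub>R t *\<^sub>R Da b" for s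
    define H' where "H' s = D (z + (s *\<^sub>R a + t *\<^sub>R b)) a - D (z + (s *\<^sub>R a + 0 *\<^sub>R b)) a - t *\<^sub>R Da b" for s
    have der: "(H has_vector_derivative H' s) (at s within {0..t})" if s: "s \<in> {0..t}" for s
    proof -
      have comp: "((\<lambda>s. u (z + (s *\<^sub>R a + s' *\<^sub>R b))) has_vector_derivative D (z + (s *\<^sub>R a + s' *\<^sub>R b)) a)
        (at s within {0..t})" if "0 \<le> s'" "s' \<le> t" for s'
      proof -
        have "((\<lambda>s. z + (s *\<^sub>R a + s' *\<^sub>R b)) has_derivative (\<lambda>h. h *\<^sub>R a)) (at s within {0..t})"
          by (auto intro!: derivative_eq_intros)
        from has_derivative_compose[OF this u[OF inS]] that s
        have "((\<lambda>s. u (z + (s *\<^sub>R a + s' *\<^sub>R b))) has_derivative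
            (\<lambda>h. D (z + (s *\<^sub>R a + s' *\<^sub>R b)) (h *\<^sub>R a))) (at s within {0..t})" by simp
        moreover have "linear (D (z + (s *\<^sub>R a + s' *\<^sub>R b)))"
          using u[OF inS[of s s']] that s has_derivative_linear by auto
        ultimately show ?thesis by (simp add: has_vector_derivative_def linear_scale)
      qed
      have lin: "((\<lambda>s. s *\<^sub>R t *\<^sub>R Da b) has_vector_derivative t *\<^sub>R Da b) (at s within {0..t})"
        unfolding has_vector_derivative_def by (auto intro!: derivative_eq_intros)
      show ?thesis unfolding H_def H'_def
        by (intro has_vector_derivative_diff comp lin) (use t in auto)
    qed
    have bd: "norm (H' s) \<le> 2 * e * t * K" if s: "s \<in> {0..t}" for s
    proof -
      let ?x = "z + (s *\<^sub>R a + t *\<^sub>R b)" and ?y = "z + (s *\<^sub>R a + 0 *\<^sub>R b)"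
      have "H' s = (D ?x a - D z a - Da (?x - z)) - (D ?y a - D z a - Da (?y - z))"
        by (simp add: H'_def linear_add[OF linDa] linear_scale[OF linDa])
      also have "norm \<dots> \<le> norm (D ?x a - D z a - Da (?x - z)) + norm (D ?y a - D z a - Da (?y - z))"
        by (rule norm_triangle_ineq4)
      also have "\<dots> \<le> e * norm (?x - z) + e * norm (?y - z)"
        using nrm[of s t] nrm[of s 0] small s by (intro add_mono d0(2)) auto
      also have "\<dots> \<le> e * (t * K) + e * (t * K)"
        using nrm[of s t] nrm[of s 0] s \<open>e > 0\<close> t by (intro add_mono mult_left_mono) auto
      finally show ?thesis by (simp add: algebra_simps)
    qed
    have "norm (H t - H 0) \<le> 2 * e * t * K * norm (t - 0)"
    proof (rule differentiable_bound[where S = "{0..t}" and f' = "\<lambda>s h. h *\<^sub>R H' s"])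
      show "(H has_derivative (\<lambda>h. h *\<^sub>R H' s)) (at s within {0..t})" if "s \<in> {0..t}" for s
        using der[OF that] by (simp add: has_vector_derivative_def)
      show "onorm (\<lambda>h. h *\<^sub>R H' s) \<le> 2 * e * t * K" if "s \<in> {0..t}" for s
        by (rule order_trans[OF _ bd[OF that]], rule onorm_bound) (auto simp: mult.commute)
    qed (use t in auto)
    then show "norm (u (z + t *\<^sub>R a + t *\<^sub>R b) - u (z + t *\<^sub>R a) - u (z + t *\<^sub>R b) + u z - t\<^sup>2 *\<^sub>R Da b)
      \<le> 2 * e * t\<^sup>2 * (norm a + norm b)"
      using t by (simp add: H_def K_def power2_eq_square algebra_simps)
  qed
qed

lemma second_derivative_symmetric:
  fixes u :: "'a::real_normed_vector \<Rightarrow> 'b::real_normed_vector"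
  assumes S: "open S" "z \<in> S" and u: "\<And>x. x \<in> S \<Longrightarrow> (u has_derivative D x) (at x)"
    and Da: "((\<lambda>x. D x a) has_derivative Da) (at z)"
    and Db: "((\<lambda>x. D x b) has_derivative Db) (at z)"
  shows "Da b = Db a"
proof -
  define K where "K = norm a + norm b"
  have bound: "norm (Da b - Db a) \<le> 4 * e * K" if e: "e > 0" for e
  proof -
    define \<Delta> where "\<Delta> t = u (z + t *\<^sub>R a + t *\<^sub>R b) - u (z + t *\<^sub>R a) - u (z + t *\<^sub>R b) + u z" for t :: real
    obtain d1 where d1: "d1 > 0" "\<And>t. 0 < t \<Longrightarrow> t < d1 \<Longrightarrow> norm (\<Delta> t - t\<^sup>2 *\<^sub>R Da b) \<le> 2 * e * t\<^sup>2 * K"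
      using second_difference_approx[OF S u Da e, of b] unfolding \<Delta>_def K_def by auto
    obtain d2 where d2: "d2 > 0" "\<And>t. 0 < t \<Longrightarrow> t < d2 \<Longrightarrow> norm (\<Delta> t - t\<^sup>2 *\<^sub>R Db a) \<le> 2 * e * t\<^sup>2 * K"
      using second_difference_approx[OF S u Db e, of a] unfolding \<Delta>_def K_def by (auto simp: algebra_simps)
    define t where "t = min d1 d2 / 2"
    have t: "0 < t" "t < d1" "t < d2" using d1(1) d2(1) by (auto simp: t_def)
    have "t\<^sup>2 * norm (Da b - Db a) = norm ((\<Delta> t - t\<^sup>2 *\<^sub>R Db a) - (\<Delta> t - t\<^sup>2 *\<^sub>R Da b))"
      by (simp add: scaleR_diff_right[symmetric])
    also have "\<dots> \<le> 2 * e * t\<^sup>2 * K + 2 * e * t\<^sup>2 * K"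
      by (rule order_trans[OF norm_triangle_ineq4 add_mono[OF d2(2)[OF t(1,3)] d1(2)[OF t(1,2)]]])
    finally have "t\<^sup>2 * norm (Da b - Db a) \<le> t\<^sup>2 * (4 * e * K)" by (simp add: algebra_simps)
    then show ?thesis using t(1) by simp
  qed
  have "norm (Da b - Db a) \<le> 0"
  proof (rule field_le_epsilon)
    fix e :: real assume "e > 0"
    have K: "K \<ge> 0" by (simp add: K_def)
    have "norm (Da b - Db a) \<le> 4 * (e / (4 * (K + 1))) * K"
      using \<open>e > 0\<close> K by (intro bound) simp
    also have "\<dots> \<le> e"
      using \<open>e > 0\<close> K by (simp add: field_simps)
    finally show "norm (Da b - Db a) \<le> 0 + e" by simp
  qed
  then show ?thesis by simp
qed

text \<open>For the Wirtinger operators only the mixed pair \<open>\<partial>\<close>, conjugate \<open>\<partial>\<close> is at issue; it is read off from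
  the symmetry in the real directions \<open>1\<close> and \<open>\<i>\<close>. This is the identity \<open>d d u = 0\<close>.\<close>

lemma wirtbar_wirt_commute:
  assumes S: "open S" "z \<in> S" and u: "\<And>x. x \<in> S \<Longrightarrow> has_wirt u (p x) (q x) x"
    and p: "has_wirt p p1 p2 z" and q: "has_wirt q q1 q2 z"
  shows "p2 = q1"
proof -
  have "((\<lambda>x. p x * v + q x * cnj v) has_derivative
      (\<lambda>w. (p1 * w + p2 * cnj w) * v + (q1 * w + q2 * cnj w) * cnj v)) (at z)" for v
    using p q unfolding has_wirt_def by (auto intro!: derivative_eq_intros)
  from second_derivative_symmetric[OF S u[unfolded has_wirt_def] this[of 1] this[of \<i>]]
  have "p2 * (2 * \<i>) = q1 * (2 * \<i>)" by (simp add: algebra_simps)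
  then show ?thesis by simp
qed

section \<open>Functions of class \<open>C\<^sup>k\<close>\<close>

lemma differentiable_on_has_wirt:
  assumes "open S" "u differentiable_on S" "z \<in> S"
  shows "has_wirt u (wirt u z) (wirtbar u z) z"
  using assms by (metis at_within_open differentiable_on_def has_wirt_wirt_wirtbar)

lemma Ck_on_cong:
  assumes "open S" "\<And>x. x \<in> S \<Longrightarrow> u x = v x" "Ck_on k S u"
  shows "Ck_on k S v"
  using assms(2,3)
proof (induction k arbitrary: u v)
  case 0
  then show ?case by (auto cong: continuous_on_cong)
next
  case (Suc k)
  have u: "u differentiable_on S" using Suc.prems by simp
  have "has_wirt v (wirt u x) (wirtbar u x) x" if "x \<in> S" for x
    by (rule has_wirt_cong[OF assms(1) that _ differentiable_on_has_wirt[OF assms(1) u that]])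
      (rule Suc.prems(1))
  note v = this
  then have "v differentiable_on S"
    by (meson differentiable_at_imp_differentiable_on has_wirt_differentiable)
  moreover have "Ck_on k S (wirt v)"
    by (rule Suc.IH[of "wirt u"]) (use Suc.prems(2) has_wirt_imp_wirt[OF v] in auto)
  moreover have "Ck_on k S (wirtbar v)"
    by (rule Suc.IH[of "wirtbar u"]) (use Suc.prems(2) has_wirt_imp_wirtbar[OF v] in auto)
  ultimately show ?case by simp
qed

text \<open>The Wirtinger derivatives of a function are known only as functions on \<open>S\<close>, whereas the recursive
  definition speaks of \<open>wirt u\<close> everywhere. This rule accepts any functions that agree with them on
  the open set \<open>S\<close>.\<close>

lemma Ck_on_SucI:
  assumes "open S" "\<And>x. x \<in> S \<Longrightarrow> has_wirt u (p x) (q x) x" "Ck_on k S p" "Ck_on k S q"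
  shows "Ck_on (Suc k) S u"
proof -
  have "u differentiable_on S"
    using assms(2) by (meson differentiable_at_imp_differentiable_on has_wirt_differentiable)
  moreover have "Ck_on k S (wirt u)"
    by (rule Ck_on_cong[OF assms(1) _ assms(3)]) (simp add: has_wirt_imp_wirt[OF assms(2)])
  moreover have "Ck_on k S (wirtbar u)"
    by (rule Ck_on_cong[OF assms(1) _ assms(4)]) (simp add: has_wirt_imp_wirtbar[OF assms(2)])
  ultimately show ?thesis by simp
qed

lemma Ck_on_Suc_has_wirt:
  "open S \<Longrightarrow> Ck_on (Suc k) S u \<Longrightarrow> z \<in> S \<Longrightarrow> has_wirt u (wirt u z) (wirtbar u z) z"
  by (simp add: differentiable_on_has_wirt)

lemma Ck_on_Suc_imp: "Ck_on (Suc k) S u \<Longrightarrow> Ck_on k S u"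
proof (induction k arbitrary: u)
  case 0
  then show ?case by (simp add: differentiable_imp_continuous_on)
next
  case (Suc k)
  then show ?case by (metis Ck_on.simps(2))
qed

lemma Ck_on_const: "open S \<Longrightarrow> Ck_on k S (\<lambda>_. a)"
proof (induction k arbitrary: a)
  case (Suc k)
  show ?case
    by (rule Ck_on_SucI[OF Suc.prems has_wirt_const Suc.IH[OF Suc.prems] Suc.IH[OF Suc.prems]])
qed simp

lemma Ck_on_add:
  assumes S: "open S"
  shows "Ck_on k S u \<Longrightarrow> Ck_on k S v \<Longrightarrow> Ck_on k S (\<lambda>x. u x + v x)"
proof (induction k arbitrary: u v)
  case 0
  then show ?case by (simp add: continuous_on_add)
next
  case (Suc k)
  have "has_wirt (\<lambda>x. u x + v x) (wirt u x + wirt v x) (wirtbar u x + wirtbar v x) x" if "x \<in> S" for x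
    by (intro has_wirt_add Ck_on_Suc_has_wirt[OF S _ that, of k] Suc.prems)
  moreover have "Ck_on k S (\<lambda>x. wirt u x + wirt v x)" "Ck_on k S (\<lambda>x. wirtbar u x + wirtbar v x)"
    using Suc.prems by (simp_all add: Suc.IH)
  ultimately show ?case by (rule Ck_on_SucI[OF S])
qed

lemma Ck_on_mult:
  assumes S: "open S"
  shows "Ck_on k S u \<Longrightarrow> Ck_on k S v \<Longrightarrow> Ck_on k S (\<lambda>x. u x * v x)"
proof (induction k arbitrary: u v)
  case 0
  then show ?case by (simp add: continuous_on_mult)
next
  case (Suc k)
  have "has_wirt (\<lambda>x. u x * v x) (wirt u x * v x + u x * wirt v x) (wirtbar u x * v x + u x * wirtbar v x) x"
    if "x \<in> S" for x
    by (intro has_wirt_mult Ck_on_Suc_has_wirt[OF S _ that, of k] Suc.prems)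
  moreover have "Ck_on k S u" "Ck_on k S v"
    using Suc.prems by (blast intro: Ck_on_Suc_imp)+
  then have "Ck_on k S (\<lambda>x. wirt u x * v x + u x * wirt v x)"
    "Ck_on k S (\<lambda>x. wirtbar u x * v x + u x * wirtbar v x)"
    using Suc.prems by (simp_all add: Suc.IH Ck_on_add[OF S])
  ultimately show ?case by (rule Ck_on_SucI[OF S])
qed

text \<open>A holomorphic outer function keeps the chain rule free of conjugates, and its derivative is again
  holomorphic, so the induction closes.\<close>

lemma Ck_on_holomorphic_comp:
  assumes S: "open S" and T: "open T"
  shows "Ck_on k S u \<Longrightarrow> u ` S \<subseteq> T \<Longrightarrow> g holomorphic_on T \<Longrightarrow> Ck_on k S (\<lambda>x. g (u x))"
proof (induction k arbitrary: g)
  case 0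
  then show ?case
    using continuous_on_compose2 holomorphic_on_imp_continuous_on by (metis Ck_on.simps(1))
next
  case (Suc k)
  show ?case
  proof (rule Ck_on_SucI[OF S])
    show "has_wirt (\<lambda>x. g (u x)) (deriv g (u x) * wirt u x) (deriv g (u x) * wirtbar u x) x"
      if "x \<in> S" for x
      by (rule has_wirt_holomorphic_comp[OF Ck_on_Suc_has_wirt[OF S Suc.prems(1) that]
            holomorphic_derivI[OF Suc.prems(3) T]])
        (use Suc.prems(2) that in blast)
    have *: "Ck_on k S (\<lambda>x. deriv g (u x))"
      by (rule Suc.IH[OF Ck_on_Suc_imp[OF Suc.prems(1)] Suc.prems(2) holomorphic_deriv[OF Suc.prems(3) T]])
    show "Ck_on k S (\<lambda>x. deriv g (u x) * wirt u x)"
      by (rule Ck_on_mult[OF S *]) (use Suc.prems(1) in simp)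
    show "Ck_on k S (\<lambda>x. deriv g (u x) * wirtbar u x)"
      by (rule Ck_on_mult[OF S *]) (use Suc.prems(1) in simp)
  qed
qed

lemma Ck_on_ident: "open S \<Longrightarrow> Ck_on k S (\<lambda>x. x)"
proof (cases k)
  case (Suc n)
  assume "open S"
  moreover have "has_wirt (\<lambda>x. x) 1 0 x" for x by (simp add: has_wirt_def)
  ultimately show ?thesis unfolding Suc
    by (intro Ck_on_SucI[where p = "\<lambda>_. 1" and q = "\<lambda>_. 0"] Ck_on_const)
qed simp

lemma smooth_on_const: "open S \<Longrightarrow> smooth_on S (\<lambda>_. a)"
  by (simp add: smooth_on_def Ck_on_const)

lemma smooth_on_add: "open S \<Longrightarrow> smooth_on S u \<Longrightarrow> smooth_on S v \<Longrightarrow> smooth_on S (\<lambda>x. u x + v x)"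
  by (simp add: smooth_on_def Ck_on_add)

lemma smooth_on_mult: "open S \<Longrightarrow> smooth_on S u \<Longrightarrow> smooth_on S v \<Longrightarrow> smooth_on S (\<lambda>x. u x * v x)"
  by (simp add: smooth_on_def Ck_on_mult)

lemma smooth_on_minus: "open S \<Longrightarrow> smooth_on S u \<Longrightarrow> smooth_on S (\<lambda>x. - u x)"
  using smooth_on_mult[OF _ smooth_on_const, of S u "-1"] by simp

lemma smooth_on_diff: "open S \<Longrightarrow> smooth_on S u \<Longrightarrow> smooth_on S v \<Longrightarrow> smooth_on S (\<lambda>x. u x - v x)"
  using smooth_on_add[OF _ _ smooth_on_minus] by simp

lemma smooth_on_holomorphic_comp:
  "open S \<Longrightarrow> open T \<Longrightarrow> smooth_on S u \<Longrightarrow> u ` S \<subseteq> T \<Longrightarrow> g holomorphic_on T \<Longrightarrow> smooth_on S (\<lambda>x. g (u x))"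
  by (simp add: smooth_on_def Ck_on_holomorphic_comp)

lemma holomorphic_smooth_on: "open S \<Longrightarrow> g holomorphic_on S \<Longrightarrow> smooth_on S g"
  using smooth_on_holomorphic_comp[of S S "\<lambda>x. x" g] by (simp add: smooth_on_def Ck_on_ident)

lemma smooth_on_wirt: "smooth_on S u \<Longrightarrow> smooth_on S (wirt u)"
  unfolding smooth_on_def by (metis Ck_on.simps(2))

lemma smooth_on_wirtbar: "smooth_on S u \<Longrightarrow> smooth_on S (wirtbar u)"
  unfolding smooth_on_def by (metis Ck_on.simps(2))

lemma smooth_on_has_wirt:
  "open S \<Longrightarrow> smooth_on S u \<Longrightarrow> z \<in> S \<Longrightarrow> has_wirt u (wirt u z) (wirtbar u z) z"
  unfolding smooth_on_def using Ck_on_Suc_has_wirt by blast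

lemma smooth_on_cong:
  "open S \<Longrightarrow> (\<And>x. x \<in> S \<Longrightarrow> u x = v x) \<Longrightarrow> smooth_on S u \<Longrightarrow> smooth_on S v"
  unfolding smooth_on_def using Ck_on_cong by blast

lemmas smooth_on_intros =
  smooth_on_const smooth_on_add smooth_on_mult smooth_on_minus smooth_on_diff
  smooth_on_wirt smooth_on_wirtbar

section \<open>Branches of logarithms\<close>

text \<open>Near \<open>z\<close> a continuous branch differs from \<open>Ln (g / g z)\<close> by a constant: continuity keeps the
  imaginary part of \<open>l x - l z\<close> below \<open>\<pi>\<close>, where \<open>Ln\<close> inverts the exponential.\<close>

lemma log_branch_has_wirt:
  assumes S: "open S" "z \<in> S" and l: "log_branch S g l" and g: "has_wirt g p q z"
  shows "has_wirt l (p / g z) (q / g z) z"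
proof -
  have cont: "continuous_on S l" and ex: "\<And>x. x \<in> S \<Longrightarrow> exp (l x) = g x"
    using l by (auto simp: log_branch_def)
  have gz: "g z \<noteq> 0" using ex[OF S(2)] by (metis exp_not_eq_zero)
  have "isCont l z" using cont S by (simp add: continuous_on_eq_continuous_at)
  then obtain d where d: "d > 0" "\<And>x. dist x z < d \<Longrightarrow> dist (l x) (l z) < pi"
    unfolding continuous_at_eps_delta using pi_gt_zero by blast
  have eq: "l z + Ln (g x / g z) = l x" if "x \<in> S \<inter> ball z d" for x
  proof -
    have "\<bar>Im (l x - l z)\<bar> < pi"
      using d(2)[of x] that abs_Im_le_cmod[of "l x - l z"] by (auto simp: dist_commute dist_norm)
    moreover have "g x / g z = exp (l x - l z)"
      using ex that S by (simp add: exp_diff)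
    ultimately show ?thesis by (simp add: Ln_exp)
  qed
  have "has_wirt (\<lambda>x. inverse (g z) * g x) (inverse (g z) * p) (inverse (g z) * q) z"
    using has_wirt_mult[OF has_wirt_const g, of "inverse (g z)"] by simp
  then have "has_wirt (\<lambda>x. Ln (inverse (g z) * g x)) (1 * (inverse (g z) * p)) (1 * (inverse (g z) * q)) z"
    by (rule has_wirt_holomorphic_comp) (use gz in \<open>auto intro!: derivative_eq_intros\<close>)
  then have "has_wirt (\<lambda>x. l z + Ln (g x / g z)) (p / g z) (q / g z) z"
    using has_wirt_add[OF has_wirt_const, of _ _ _ z "l z"] by (fastforce simp: field_simps)
  then show ?thesis
    by (rule has_wirt_cong[rotated 3, where S = "S \<inter> ball z d"]) (use S d eq in auto)
qed

lemma log_branch_holomorphic: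
  assumes "open S" "g holomorphic_on S" "log_branch S g l"
  shows "l holomorphic_on S"
    and "z \<in> S \<Longrightarrow> (l has_field_derivative deriv g z / g z) (at z)"
proof -
  have *: "(l has_field_derivative deriv g z / g z) (at z)" if "z \<in> S" for z
    using log_branch_has_wirt[OF assms(1) that assms(3), of "deriv g z" 0] holomorphic_derivI[OF assms(2,1) that]
    by (simp add: has_wirt_holomorphic_iff)
  then show "l holomorphic_on S" using assms(1) by (auto simp: holomorphic_on_open)
  show "z \<in> S \<Longrightarrow> (l has_field_derivative deriv g z / g z) (at z)" using * .
qed

text \<open>The derivatives of \<open>l\<close> are those of \<open>g\<close> times \<open>exp (- l)\<close>, so each order of differentiability of \<open>l\<close>
  yields the next one.\<close>

lemma log_branch_smooth_on:
  assumes S: "open S" and l: "log_branch S g l" and g: "smooth_on S g"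
  shows "smooth_on S l"
proof -
  have "Ck_on k S l" for k
  proof (induction k)
    case 0
    then show ?case using l by (simp add: log_branch_def)
  next
    case (Suc k)
    have "Ck_on k S (\<lambda>x. exp (- l x))"
      by (rule Ck_on_holomorphic_comp[OF S open_UNIV Suc, of "\<lambda>w. exp (- w)"])
        (simp, intro holomorphic_intros)
    then show ?case
    proof (intro Ck_on_SucI[OF S, where p = "\<lambda>x. exp (- l x) * wirt g x" and q = "\<lambda>x. exp (- l x) * wirtbar g x"] Ck_on_mult[OF S])
      fix x assume x: "x \<in> S"
      have "exp (- l x) = inverse (g x)" using l x by (simp add: log_branch_def exp_minus)
      with log_branch_has_wirt[OF S x l smooth_on_has_wirt[OF S g x]]
      show "has_wirt l (exp (- l x) * wirt g x) (exp (- l x) * wirtbar g x) x"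
        by (simp add: field_simps)
    qed (use smooth_on_wirt[OF g] smooth_on_wirtbar[OF g] in \<open>auto simp: smooth_on_def\<close>)
  qed
  then show ?thesis by (simp add: smooth_on_def)
qed

section \<open>Periods\<close>

lemma ZZ_add: "x \<in> ZZ p \<Longrightarrow> y \<in> ZZ p \<Longrightarrow> x + y \<in> ZZ p"
  unfolding ZZ_def by (auto simp flip: distrib_left of_int_add)

lemma ZZ_minus: "x \<in> ZZ p \<Longrightarrow> - x \<in> ZZ p"
  unfolding ZZ_def by (auto simp flip: mult_minus_right of_int_minus)

lemma ZZ_diff: "x \<in> ZZ p \<Longrightarrow> y \<in> ZZ p \<Longrightarrow> x - y \<in> ZZ p"
  using ZZ_add[OF _ ZZ_minus] by simp

lemma ZZ_mult:
  assumes "x \<in> ZZ p" "y \<in> ZZ q" shows "x * y \<in> ZZ (p + q)"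
proof -
  obtain j k where "x = (2 * of_real pi * \<i>) ^ p * of_int j" "y = (2 * of_real pi * \<i>) ^ q * of_int k"
    using assms by (auto simp: ZZ_def)
  then have "x * y = (2 * of_real pi * \<i>) ^ (p + q) * of_int (j * k)"
    by (simp add: power_add)
  then show ?thesis unfolding ZZ_def by blast
qed

lemma period_in_ZZ_1: "2 * of_real pi * \<i> \<in> ZZ 1"
  unfolding ZZ_def by (auto intro!: exI[of _ 1])

text \<open>Distinct periods are at distance at least \<open>2\<pi>\<close>, so a continuous choice of period cannot jump.\<close>

lemma exp_eq_1_constant_period:
  assumes "connected S" "S \<noteq> {}" "continuous_on S k" "\<And>z. z \<in> S \<Longrightarrow> exp (k z) = (1::complex)"
  obtains a where "a \<in> ZZ 1" "\<And>z. z \<in> S \<Longrightarrow> k z = a"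
proof -
  have "k constant_on S"
  proof (rule continuous_discrete_range_constant[OF assms(1,3)])
    fix x assume x: "x \<in> S"
    have "2 * pi \<le> norm (k y - k x)" if "y \<in> S \<and> k y \<noteq> k x" for y
    proof (rule ccontr)
      assume "\<not> 2 * pi \<le> norm (k y - k x)"
      moreover have "exp (k y) = exp (k x)" using assms(4) x that by simp
      ultimately show False
        using abs_Im_le_cmod[of "k y - k x"] exp_complex_eqI[of "k y" "k x"] that by auto
    qed
    then show "\<exists>e>0. \<forall>y. y \<in> S \<and> k y \<noteq> k x \<longrightarrow> e \<le> norm (k y - k x)"
      by (intro exI[of _ "2 * pi"]) auto
  qed
  then obtain a where a: "\<And>z. z \<in> S \<Longrightarrow> k z = a" by (auto simp: constant_on_def)
  then have "exp a = 1" using assms(2,4) by force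
  then obtain j :: int where "Re a = 0" "Im a = of_int (2 * j) * pi" by (auto simp: exp_eq_1)
  then have "a = 2 * of_real pi * \<i> * of_int j" by (simp add: complex_eq_iff)
  then have "a \<in> ZZ 1" by (auto simp: ZZ_def)
  with a that show thesis by blast
qed

text \<open>By the chain rule the derivatives of a group action are multiplicative, so their logarithms are
  additive up to a period.\<close>

lemma log_cocycle_constant:
  assumes S: "open S" "connected S" "S \<noteq> {}"
    and hol: "T g1 holomorphic_on S" "T g2 holomorphic_on S"
    and maps: "\<And>z. z \<in> S \<Longrightarrow> T g2 z \<in> S"
    and comp: "\<And>z. z \<in> S \<Longrightarrow> T (g1 \<otimes>\<^bsub>PSL2C\<^esub> g2) z = T g1 (T g2 z)"
    and l: "log_branch S (deriv (T g1)) (l g1)" "log_branch S (deriv (T g2)) (l g2)"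
      "log_branch S (deriv (T (g1 \<otimes>\<^bsub>PSL2C\<^esub> g2))) (l (g1 \<otimes>\<^bsub>PSL2C\<^esub> g2))"
  shows "log_cocycle T S l g1 g2 \<in> ZZ 1"
    and "\<And>z. z \<in> S \<Longrightarrow> log_cocycle T S l g1 g2 = l g2 z - l (g1 \<otimes>\<^bsub>PSL2C\<^esub> g2) z + l g1 (T g2 z)"
proof -
  let ?g = "g1 \<otimes>\<^bsub>PSL2C\<^esub> g2"
  let ?k = "\<lambda>z. l g2 z - l ?g z + l g1 (T g2 z)"
  have "continuous_on S (\<lambda>z. l g1 (T g2 z))"
    using l(1) maps holomorphic_on_imp_continuous_on[OF hol(2)]
    by (auto simp: log_branch_def intro: continuous_on_compose2)
  then have cont: "continuous_on S ?k"
    using l by (auto simp: log_branch_def intro!: continuous_intros)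
  have exp1: "exp (?k z) = 1" if z: "z \<in> S" for z
  proof -
    have "((\<lambda>z. T g1 (T g2 z)) has_field_derivative deriv (T g1) (T g2 z) * deriv (T g2) z) (at z)"
      by (rule DERIV_chain2[OF holomorphic_derivI[OF hol(1) S(1) maps[OF z]] holomorphic_derivI[OF hol(2) S(1) z]])
    then have "(T ?g has_field_derivative deriv (T g1) (T g2 z) * deriv (T g2) z) (at z)"
      by (rule has_field_derivative_transform_within_open[OF _ S(1) z]) (simp add: comp)
    then have "deriv (T ?g) z = deriv (T g1) (T g2 z) * deriv (T g2) z" by (rule DERIV_imp_deriv)
    then have "exp (l ?g z) = exp (l g1 (T g2 z)) * exp (l g2 z)"
      using l z maps[OF z] by (simp add: log_branch_def)
    then show ?thesis by (simp add: exp_add exp_diff)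
  qed
  obtain a where a: "a \<in> ZZ 1" "\<And>z. z \<in> S \<Longrightarrow> ?k z = a"
    using exp_eq_1_constant_period[OF S(2,3) cont exp1] by blast
  have "log_cocycle T S l g1 g2 = a"
    unfolding log_cocycle_def using a(2) S(3) by (intro the_equality) auto
  with a show "log_cocycle T S l g1 g2 \<in> ZZ 1"
    "\<And>z. z \<in> S \<Longrightarrow> log_cocycle T S l g1 g2 = l g2 z - l ?g z + l g1 (T g2 z)" by auto
qed

section \<open>Fractional linear transformations\<close>

lemma PSL2C_elementE:
  assumes "g \<in> carrier PSL2C"
  obtains A where "det A = 1" "g = {A, - A}"
proof -
  obtain A where A: "det A = 1" "g = {mat 1 ** A, - mat 1 ** A}"
    using assms by (auto simp: PSL2C_def FactGroup_def RCOSETS_def r_coset_def SL2C_def)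
  have "- mat 1 ** A = - A"
    by (simp add: vec_eq_iff matrix_matrix_mult_def mat_def sum_2 forall_2)
  with A that show thesis by simp
qed

lemma PSL2C_mult: "g1 \<otimes>\<^bsub>PSL2C\<^esub> g2 = {A ** B | A B. A \<in> g1 \<and> B \<in> g2}"
  by (auto simp: PSL2C_def FactGroup_def set_mult_def SL2C_def)

lemma PSL2C_assoc: "(g1 \<otimes>\<^bsub>PSL2C\<^esub> g2) \<otimes>\<^bsub>PSL2C\<^esub> g3 = g1 \<otimes>\<^bsub>PSL2C\<^esub> (g2 \<otimes>\<^bsub>PSL2C\<^esub> g3)"
  unfolding PSL2C_mult by (auto; metis matrix_mul_assoc)

lemma mob_representative:
  assumes "g \<in> carrier PSL2C" "A \<in> g"
  shows "mob g z = (A$1$1 * z + A$1$2) / (A$2$1 * z + A$2$2)"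
proof -
  define B where "B = (SOME B. B \<in> g)"
  have "B \<in> g" unfolding B_def using assms(2) by (rule someI)
  then have "B = A \<or> B = - A"
    using assms by (metis PSL2C_elementE insertE minus_minus singletonD)
  moreover have "(- p * z + - q) / (- r * z + - s) = (p * z + q) / (r * z + s)" for p q r s
    by (metis minus_add_distrib minus_divide_divide mult_minus_left)
  ultimately show ?thesis
    unfolding mob_def Let_def B_def[symmetric] by auto
qed

lemma mob_mult:
  assumes g: "g1 \<in> carrier PSL2C" "g2 \<in> carrier PSL2C" "g1 \<otimes>\<^bsub>PSL2C\<^esub> g2 \<in> carrier PSL2C"
    and fin: "finite_at g2 z"
  shows "mob (g1 \<otimes>\<^bsub>PSL2C\<^esub> g2) z = mob g1 (mob g2 z)"
proof -
  obtain A where A: "A \<in> g1" using PSL2C_elementE[OF g(1)] by blast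
  obtain B where B: "B \<in> g2" using PSL2C_elementE[OF g(2)] by blast
  have AB: "A ** B \<in> g1 \<otimes>\<^bsub>PSL2C\<^esub> g2" using A B by (auto simp: PSL2C_mult)
  have nz: "B$2$1 * z + B$2$2 \<noteq> 0" using fin B by (simp add: finite_at_def)
  \<comment> \<open>Clearing \<open>d\<close> is possible even when the outer denominator vanishes, since then both sides are \<open>0\<close>.\<close>
  have clear: "(p * (n / d) + q) / (r * (n / d) + s) = (p * n + q * d) / (r * n + s * d)"
    if "d \<noteq> 0" for p q r s n d :: complex
  proof -
    have "p * (n / d) + q = (p * n + q * d) / d" "r * (n / d) + s = (r * n + s * d) / d"
      using that by (simp_all add: field_simps)
    then show ?thesis using that by simp
  qed
  show ?thesis
    unfolding mob_representative[OF g(3) AB] mob_representative[OF g(1) A] mob_representative[OF g(2) B]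
      clear[OF nz]
    by (simp add: matrix_matrix_mult_def sum_2 algebra_simps)
qed

text \<open>With denominator \<open>r\<close> the derivative is \<open>1 / r\<^sup>2\<close>, so the logarithm \<open>l\<close> of the derivative has
  \<open>l' = - 2 r' / r\<close> and satisfies \<open>l'' = l'\<^sup>2 / 2\<close>: the Schwarzian derivative of a fractional linear
  transformation vanishes.\<close>

lemma mob_derivatives:
  assumes g: "g \<in> carrier PSL2C" and S: "open S" and fin: "\<And>z. z \<in> S \<Longrightarrow> finite_at g z"
  shows mob_holomorphic: "mob g holomorphic_on S"
    and mob_schwarzian: "\<And>l z. log_branch S (deriv (mob g)) l \<Longrightarrow> z \<in> S \<Longrightarrow>
      deriv l z = deriv (deriv (mob g)) z / deriv (mob g) z \<and>
      (deriv l has_field_derivative (deriv l z)\<^sup>2 / 2) (at z)"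
proof -
  obtain A where A: "det A = 1" "A \<in> g" using PSL2C_elementE[OF g] by blast
  have det: "A$1$1 * A$2$2 - A$1$2 * A$2$1 = 1" using A(1) by (simp add: det_2)
  define r where "r z = A$2$1 * z + A$2$2" for z
  have nz: "r z \<noteq> 0" if "z \<in> S" for z using fin[OF that] A(2) by (simp add: r_def finite_at_def)
  have r: "(r has_field_derivative A$2$1) (at z)" for z
    unfolding r_def by (auto intro!: derivative_eq_intros)
  have mob: "mob g = (\<lambda>z. (A$1$1 * z + A$1$2) / r z)"
    using mob_representative[OF g A(2)] by (auto simp: r_def)
  have d1: "(mob g has_field_derivative 1 / (r z)\<^sup>2) (at z)" if "z \<in> S" for z
  proof -
    have "A$1$1 * r z - (A$1$1 * z + A$1$2) * A$2$1 = 1"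
      using det by (simp add: r_def algebra_simps)
    then show ?thesis unfolding mob using nz[OF that]
      by (auto intro!: derivative_eq_intros r simp: power2_eq_square)
  qed
  then show hol: "mob g holomorphic_on S" using S by (auto simp: holomorphic_on_open)
  have D1: "deriv (mob g) z = 1 / (r z)\<^sup>2" if "z \<in> S" for z
    using d1[OF that] by (rule DERIV_imp_deriv)
  have D2: "deriv (deriv (mob g)) z = - 2 * A$2$1 / (r z) ^ 3" if "z \<in> S" for z
  proof (rule DERIV_imp_deriv)
    have "((\<lambda>z. 1 / (r z)\<^sup>2) has_field_derivative - 2 * A$2$1 / (r z) ^ 3) (at z)"
      using nz[OF that] by (auto intro!: derivative_eq_intros r simp: field_simps eval_nat_numeral)
    then show "(deriv (mob g) has_field_derivative - 2 * A$2$1 / (r z) ^ 3) (at z)"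
      by (rule has_field_derivative_transform_within_open[OF _ S that]) (simp add: D1)
  qed
  fix l z assume l: "log_branch S (deriv (mob g)) l" and z: "z \<in> S"
  have dl: "deriv l z = deriv (deriv (mob g)) z / deriv (mob g) z" if "z \<in> S" for z
    using log_branch_holomorphic(2)[OF S holomorphic_deriv[OF hol S] l that] by (rule DERIV_imp_deriv)
  then have dl': "deriv l z = - 2 * A$2$1 / r z" if "z \<in> S" for z
    using that nz[OF that] by (simp add: D1 D2 eval_nat_numeral)
  have "((\<lambda>z. - 2 * A$2$1 / r z) has_field_derivative (deriv l z)\<^sup>2 / 2) (at z)"
    using nz[OF z] unfolding dl'[OF z]
    by (auto intro!: derivative_eq_intros r simp: field_simps power2_eq_square)
  then have "(deriv l has_field_derivative (deriv l z)\<^sup>2 / 2) (at z)"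
    by (rule has_field_derivative_transform_within_open[OF _ S z]) (simp add: dl')
  with dl z show "deriv l z = deriv (deriv (mob g)) z / deriv (mob g) z \<and>
      (deriv l has_field_derivative (deriv l z)\<^sup>2 / 2) (at z)" by blast
qed

lemma PSL2R_upper_half_plane:
  assumes g: "g \<in> PSL2R" and z: "z \<in> UH"
  shows "finite_at g z" and "mob g z \<in> UH"
proof -
  have gc: "g \<in> carrier PSL2C" using g by (simp add: PSL2R_def)
  have nz: "A$2$1 * z + A$2$2 \<noteq> 0" and im: "Im ((A$1$1 * z + A$1$2) / (A$2$1 * z + A$2$2)) > 0"
    if A: "A \<in> g" for A
  proof -
    have "det A = 1 \<or> det (- A) = 1"
      using PSL2C_elementE[OF gc] A by (metis insertE minus_minus singletonD)
    then have "det A = 1" by (simp add: det_2)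
    have "\<And>i j. A$i$j \<in> \<real>" using g A by (auto simp: PSL2R_def)
    then obtain a b c d where abcd: "A$1$1 = of_real a" "A$1$2 = of_real b" "A$2$1 = of_real c" "A$2$2 = of_real d"
      by (meson Reals_cases)
    with \<open>det A = 1\<close> have "of_real (a * d - b * c) = (1::complex)" by (simp add: det_2)
    then have det: "a * d - b * c = 1" using of_real_eq_1_iff by blast
    have "Im z > 0" using z by (simp add: UH_def)
    show nz: "A$2$1 * z + A$2$2 \<noteq> 0"
    proof
      assume "A$2$1 * z + A$2$2 = 0"
      then have "c * Im z = 0" "c * Re z + d = 0" by (auto simp: abcd complex_eq_iff)
      with \<open>Im z > 0\<close> det show False by auto
    qed
    have "Im ((A$1$1 * z + A$1$2) / (A$2$1 * z + A$2$2))
      = (a * d - b * c) * Im z / (cmod (A$2$1 * z + A$2$2))\<^sup>2"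
      unfolding Im_divide cmod_power2 by (simp add: abcd algebra_simps)
    then show "Im ((A$1$1 * z + A$1$2) / (A$2$1 * z + A$2$2)) > 0"
      using nz det \<open>Im z > 0\<close> by simp
  qed
  show "finite_at g z" using nz by (simp add: finite_at_def)
  obtain A where "A \<in> g" using PSL2C_elementE[OF gc] by blast
  with im mob_representative[OF gc] show "mob g z \<in> UH" by (simp add: UH_def)
qed

lemma open_UH: "open UH" and connected_UH: "connected UH" and UH_nonempty: "UH \<noteq> {}"
proof -
  show "open UH" unfolding UH_def by (rule open_halfspace_Im_gt)
  show "connected UH" unfolding UH_def by (intro convex_connected convex_halfspace_Im_gt)
  have "\<i> \<in> UH" by (simp add: UH_def)
  then show "UH \<noteq> {}" by blast
qed

section \<open>Forms and coboundaries in low degree\<close>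

lemma length_1_conv: "length vs = Suc 0 \<longleftrightarrow> (\<exists>v. vs = [v])"
  by (auto simp: length_Suc_conv)

lemma length_2_conv: "length vs = Suc (Suc 0) \<longleftrightarrow> (\<exists>v w. vs = [v, w])"
  by (auto simp: length_Suc_conv)

lemma ext_d_fn_form: "ext_d (fn_form u) z [v] = frechet_derivative u (at z) v"
  by (simp add: ext_d_def fn_form_def)

lemma ext_d_function:
  assumes "open S" "z \<in> S" "\<And>x. x \<in> S \<Longrightarrow> u x = \<alpha> x []" "has_wirt u p q z"
  shows "ext_d \<alpha> z [v] = p * v + q * cnj v"
  using has_wirt_frechet[OF has_wirt_cong[OF assms]] by (simp add: ext_d_def)

lemma ext_d_one_form:
  assumes S: "open S" "z \<in> S"
    and \<alpha>: "\<And>x v. x \<in> S \<Longrightarrow> P x * v + Q x * cnj v = \<alpha> x [v]"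
    and P: "has_wirt P p1 p2 z" and Q: "has_wirt Q q1 q2 z"
  shows "ext_d \<alpha> z [v, w] = (q1 - p2) * (v * cnj w - w * cnj v)"
proof -
  have "frechet_derivative (\<lambda>x. \<alpha> x [w]) (at z) v =
      (p1 * w + q1 * cnj w) * v + (p2 * w + q2 * cnj w) * cnj v" for v w
  proof -
    have "has_wirt (\<lambda>x. P x * w + Q x * cnj w) (p1 * w + q1 * cnj w) (p2 * w + q2 * cnj w) z"
      using has_wirt_add[OF has_wirt_mult[OF P has_wirt_const[of w]] has_wirt_mult[OF Q has_wirt_const[of "cnj w"]]]
      by simp
    from has_wirt_frechet[OF has_wirt_cong[OF S \<alpha> this]] show ?thesis by simp
  qed
  then show ?thesis by (simp add: ext_d_def algebra_simps)
qed

lemma smooth_zero_formI: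
  assumes "smooth_on S (\<lambda>z. \<alpha> z [])" shows "\<alpha> \<in> smooth_forms S 0"
  using assms by (simp add: smooth_forms_def)

lemma smooth_one_formI:
  assumes S: "open S" and P: "smooth_on S P" and Q: "smooth_on S Q"
    and \<alpha>: "\<And>z v. z \<in> S \<Longrightarrow> \<alpha> z [v] = P z * v + Q z * cnj v"
  shows "\<alpha> \<in> smooth_forms S 1"
proof -
  have "smooth_on S (\<lambda>z. \<alpha> z [v])" for v
    by (rule smooth_on_cong[OF S, where u = "\<lambda>z. P z * v + Q z * cnj v"])
      (simp_all add: \<alpha> S P Q smooth_on_intros)
  moreover have "linear (\<lambda>v. \<alpha> z [v])" if "z \<in> S" for z
    by (rule linearI) (simp_all add: \<alpha> that algebra_simps scaleR_conv_of_real)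
  ultimately show ?thesis by (auto simp: smooth_forms_def length_1_conv)
qed

lemma smooth_two_formI:
  assumes S: "open S" and W: "smooth_on S W"
    and \<alpha>: "\<And>z v w. z \<in> S \<Longrightarrow> \<alpha> z [v, w] = W z * (v * cnj w - w * cnj v)"
  shows "\<alpha> \<in> smooth_forms S 2"
proof -
  have "smooth_on S (\<lambda>z. \<alpha> z [v, w])" for v w
    by (rule smooth_on_cong[OF S, where u = "\<lambda>z. W z * (v * cnj w - w * cnj v)"])
      (simp_all add: \<alpha> S W smooth_on_intros)
  moreover have "linear (\<lambda>v. \<alpha> z [v, w])" "linear (\<lambda>v. \<alpha> z [w, v])" if "z \<in> S" for z w
    by (rule linearI; simp add: \<alpha> that algebra_simps scaleR_conv_of_real)+
  moreover have "\<alpha> z [v, v] = 0" if "z \<in> S" for z v using \<alpha>[OF that] by simp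
  ultimately show ?thesis
    by (auto simp: smooth_forms_def length_2_conv less_Suc_eq numeral_2_eq_2)
qed

lemma cobd_1: "cobd T \<phi> [g] z vs = \<phi> [] z vs - pullback (T g) (\<phi> []) z vs"
  by (simp add: cobd_def)

lemma cobd_2: "cobd T \<phi> [g1, g2] z vs =
    \<phi> [g2] z vs - \<phi> [g1 \<otimes>\<^bsub>PSL2C\<^esub> g2] z vs + pullback (T g2) (\<phi> [g1]) z vs"
  by (simp add: cobd_def merge_at_def)

lemma cobd_3: "cobd T \<phi> [g1, g2, g3] z vs =
    \<phi> [g2, g3] z vs - \<phi> [g1 \<otimes>\<^bsub>PSL2C\<^esub> g2, g3] z vs + \<phi> [g1, g2 \<otimes>\<^bsub>PSL2C\<^esub> g3] z vs
    - pullback (T g3) (\<phi> [g1, g2]) z vs"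
  by (simp add: cobd_def merge_at_def numeral_2_eq_2 atLeastAtMostSuc_conv)

lemma cobd_4: "cobd T \<phi> [g1, g2, g3, g4] z vs =
    \<phi> [g2, g3, g4] z vs - \<phi> [g1 \<otimes>\<^bsub>PSL2C\<^esub> g2, g3, g4] z vs + \<phi> [g1, g2 \<otimes>\<^bsub>PSL2C\<^esub> g3, g4] z vs
    - \<phi> [g1, g2, g3 \<otimes>\<^bsub>PSL2C\<^esub> g4] z vs + pullback (T g4) (\<phi> [g1, g2, g3]) z vs"
  by (simp add: cobd_def merge_at_def numeral_3_eq_3 numeral_2_eq_2 atLeastAtMostSuc_conv)

section \<open>The logarithms of an equivariant quasi-conformal map\<close>

locale equivariant_map =
  fixes \<Gamma> :: "psl set" and tilde :: "psl \<Rightarrow> psl" and \<mu> f :: "complex \<Rightarrow> complex" and \<D> :: "complex set"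
    and l lt :: "psl \<Rightarrow> complex \<Rightarrow> complex" and lf :: "complex \<Rightarrow> complex"
  assumes subgroup: "subgroup \<Gamma> PSL2C" and real: "\<Gamma> \<subseteq> PSL2R"
    and beltrami: "beltrami_differential \<Gamma> \<mu>"
    and image: "\<D> = f ` UH" and open_image: "open \<D>" and f_smooth: "smooth_on UH f"
    and f_beltrami: "\<And>z. z \<in> UH \<Longrightarrow> wirtbar f z = \<mu> z * wirt f z"
    and tilde: "\<And>\<gamma>. \<gamma> \<in> \<Gamma> \<Longrightarrow> tilde \<gamma> \<in> carrier PSL2C"
    and equivariant: "\<And>\<gamma> z. \<gamma> \<in> \<Gamma> \<Longrightarrow> z \<in> UH \<Longrightarrow>
           finite_at (tilde \<gamma>) (f z) \<and> mob (tilde \<gamma>) (f z) = f (mob \<gamma> z)"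
    and l: "\<And>\<gamma>. \<gamma> \<in> \<Gamma> \<Longrightarrow> log_branch UH (deriv (mob \<gamma>)) (l \<gamma>)"
    and lt: "\<And>\<gamma>. \<gamma> \<in> \<Gamma> \<Longrightarrow> log_branch \<D> (deriv (mob (tilde \<gamma>))) (lt \<gamma>)"
    and lf: "log_branch UH (wirt f) lf"
begin

abbreviation mult (infixl "\<cdot>" 70) where "g1 \<cdot> g2 \<equiv> g1 \<otimes>\<^bsub>PSL2C\<^esub> g2"

abbreviation "c \<equiv> log_cocycle mob UH l"
abbreviation "ct \<equiv> log_cocycle (\<lambda>\<gamma>. mob (tilde \<gamma>)) \<D> lt"
abbreviation "b \<equiv> b_const f l lt lf"

lemma mult_closed: "g1 \<in> \<Gamma> \<Longrightarrow> g2 \<in> \<Gamma> \<Longrightarrow> g1 \<cdot> g2 \<in> \<Gamma>"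
  using subgroup by (rule subgroup.m_closed)

lemma carrier: "g \<in> \<Gamma> \<Longrightarrow> g \<in> carrier PSL2C"
  using subgroup.subset[OF subgroup] by blast

lemma mob_UH: "g \<in> \<Gamma> \<Longrightarrow> z \<in> UH \<Longrightarrow> mob g z \<in> UH"
  using PSL2R_upper_half_plane real by blast

lemma finite_UH: "g \<in> \<Gamma> \<Longrightarrow> z \<in> UH \<Longrightarrow> finite_at g z"
  using PSL2R_upper_half_plane real by blast

lemma mob_comp: "g1 \<in> \<Gamma> \<Longrightarrow> g2 \<in> \<Gamma> \<Longrightarrow> z \<in> UH \<Longrightarrow> mob (g1 \<cdot> g2) z = mob g1 (mob g2 z)"
  by (intro mob_mult carrier mult_closed finite_UH)

lemma mob_holomorphic_UH: "g \<in> \<Gamma> \<Longrightarrow> mob g holomorphic_on UH"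
  by (intro mob_holomorphic carrier open_UH finite_UH)

lemma mob_tilde_holomorphic: "g \<in> \<Gamma> \<Longrightarrow> mob (tilde g) holomorphic_on \<D>"
  using equivariant by (intro mob_holomorphic tilde open_image) (auto simp: image)

lemma mob_has_deriv: "g \<in> \<Gamma> \<Longrightarrow> z \<in> UH \<Longrightarrow> (mob g has_field_derivative deriv (mob g) z) (at z)"
  using holomorphic_derivI mob_holomorphic_UH open_UH by blast

lemma mob_deriv_nonzero_UH: "g \<in> \<Gamma> \<Longrightarrow> z \<in> UH \<Longrightarrow> deriv (mob g) z \<noteq> 0"
  using l unfolding log_branch_def by (metis exp_not_eq_zero)

lemma f_image: "z \<in> UH \<Longrightarrow> f z \<in> \<D>"
  by (simp add: image)

lemma f_has_wirt: "z \<in> UH \<Longrightarrow> has_wirt f (wirt f z) (wirtbar f z) z"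
  using smooth_on_has_wirt open_UH f_smooth by blast

lemma wirt_f_nonzero: "z \<in> UH \<Longrightarrow> wirt f z \<noteq> 0"
  using lf unfolding log_branch_def by (metis exp_not_eq_zero)

lemma mu_smooth: "smooth_on UH \<mu>"
  using beltrami by (simp add: beltrami_differential_def)

lemma lf_smooth: "smooth_on UH lf"
  by (rule log_branch_smooth_on[OF open_UH lf smooth_on_wirt[OF f_smooth]])

lemma lf_has_wirt: "z \<in> UH \<Longrightarrow> has_wirt lf (wirt lf z) (wirtbar lf z) z"
  using smooth_on_has_wirt open_UH lf_smooth by blast

lemma l_holomorphic: "g \<in> \<Gamma> \<Longrightarrow> l g holomorphic_on UH"
  by (rule log_branch_holomorphic(1)[OF open_UH holomorphic_deriv[OF mob_holomorphic_UH open_UH] l])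

lemma lt_holomorphic: "g \<in> \<Gamma> \<Longrightarrow> lt g holomorphic_on \<D>"
  by (rule log_branch_holomorphic(1)[OF open_image holomorphic_deriv[OF mob_tilde_holomorphic open_image] lt])

lemma l_has_wirt: "g \<in> \<Gamma> \<Longrightarrow> z \<in> UH \<Longrightarrow> has_wirt (l g) (deriv (l g) z) 0 z"
  using holomorphic_derivI[OF l_holomorphic open_UH] by (simp add: has_wirt_holomorphic_iff)

lemma holomorphic_f_has_wirt:
  "u holomorphic_on \<D> \<Longrightarrow> z \<in> UH \<Longrightarrow>
    has_wirt (\<lambda>x. u (f x)) (deriv u (f z) * wirt f z) (deriv u (f z) * wirtbar f z) z"
  using has_wirt_holomorphic_comp[OF f_has_wirt holomorphic_derivI[OF _ open_image f_image]] by blast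

lemma holomorphic_f_smooth: "u holomorphic_on \<D> \<Longrightarrow> smooth_on UH (\<lambda>x. u (f x))"
  by (rule smooth_on_holomorphic_comp[OF open_UH open_image f_smooth]) (simp_all add: image)

lemma mob_f: "g \<in> \<Gamma> \<Longrightarrow> z \<in> UH \<Longrightarrow> mob (tilde g) (f z) = f (mob g z)"
  using equivariant by blast

lemma c_period: "g1 \<in> \<Gamma> \<Longrightarrow> g2 \<in> \<Gamma> \<Longrightarrow> c g1 g2 \<in> ZZ 1"
  and c_eq: "g1 \<in> \<Gamma> \<Longrightarrow> g2 \<in> \<Gamma> \<Longrightarrow> z \<in> UH \<Longrightarrow> c g1 g2 = l g2 z - l (g1 \<cdot> g2) z + l g1 (mob g2 z)"
  by (intro log_cocycle_constant open_UH connected_UH UH_nonempty mob_holomorphic_UH mob_UH mob_comp l mult_closed;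
      assumption)+

lemma image_connected: "connected \<D>" and image_nonempty: "\<D> \<noteq> {}"
proof -
  have "continuous_on UH f" using f_smooth by (metis smooth_on_def Ck_on.simps(1))
  then show "connected \<D>" unfolding image by (intro connected_continuous_image connected_UH)
  show "\<D> \<noteq> {}" using UH_nonempty by (simp add: image)
qed

lemma ct_period: "g1 \<in> \<Gamma> \<Longrightarrow> g2 \<in> \<Gamma> \<Longrightarrow> ct g1 g2 \<in> ZZ 1"
  and ct_eq: "g1 \<in> \<Gamma> \<Longrightarrow> g2 \<in> \<Gamma> \<Longrightarrow> z \<in> UH \<Longrightarrow>
    ct g1 g2 = lt g2 (f z) - lt (g1 \<cdot> g2) (f z) + lt g1 (f (mob g2 z))"
proof -
  assume g: "g1 \<in> \<Gamma>" "g2 \<in> \<Gamma>"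
  have maps: "mob (tilde g2) w \<in> \<D>" if "w \<in> \<D>" for w
    using that g by (auto simp: image mob_f mob_UH)
  have comp: "mob (tilde (g1 \<cdot> g2)) w = mob (tilde g1) (mob (tilde g2) w)" if "w \<in> \<D>" for w
    using that g by (auto simp: image mob_f mob_UH mob_comp mult_closed)
  note * = log_cocycle_constant[where T = "\<lambda>\<gamma>. mob (tilde \<gamma>)", OF open_image image_connected image_nonempty
    mob_tilde_holomorphic[OF g(1)] mob_tilde_holomorphic[OF g(2)] maps comp lt[OF g(1)] lt[OF g(2)] lt[OF mult_closed[OF g]]]
  show "ct g1 g2 \<in> ZZ 1" using * by blast
  show "z \<in> UH \<Longrightarrow> ct g1 g2 = lt g2 (f z) - lt (g1 \<cdot> g2) (f z) + lt g1 (f (mob g2 z))"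
    using *(2)[OF _ _ f_image] mob_f[OF g(2)] by simp
qed

text \<open>Wirtinger derivatives of the two sides of \<open>f \<circ> \<gamma> = \<gamma>~ \<circ> f\<close>.\<close>

lemma f_mob_wirt:
  assumes g: "g \<in> \<Gamma>" and z: "z \<in> UH"
  shows "deriv (mob (tilde g)) (f z) * wirt f z = wirt f (mob g z) * deriv (mob g) z"
    and "deriv (mob (tilde g)) (f z) * wirtbar f z = wirtbar f (mob g z) * cnj (deriv (mob g) z)"
proof -
  have 1: "has_wirt (\<lambda>x. f (mob g x)) (wirt f (mob g z) * deriv (mob g) z)
      (wirtbar f (mob g z) * cnj (deriv (mob g) z)) z"
    by (rule has_wirt_comp_holomorphic[OF mob_has_deriv[OF g z] f_has_wirt[OF mob_UH[OF g z]]])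
  have "has_wirt (\<lambda>x. f (mob g x)) (deriv (mob (tilde g)) (f z) * wirt f z)
      (deriv (mob (tilde g)) (f z) * wirtbar f z) z"
    by (rule has_wirt_cong[OF open_UH z _ holomorphic_f_has_wirt[OF mob_tilde_holomorphic[OF g] z]])
      (rule mob_f[OF g])
  from has_wirt_unique[OF this 1]
  show "deriv (mob (tilde g)) (f z) * wirt f z = wirt f (mob g z) * deriv (mob g) z"
    "deriv (mob (tilde g)) (f z) * wirtbar f z = wirtbar f (mob g z) * cnj (deriv (mob g) z)" by auto
qed

text \<open>The logarithm of the first identity in \<open>f_mob_wirt\<close>. The constant \<open>b\<close> links the logarithms
  on \<open>UH\<close> to those on \<open>\<D>\<close>; every later cancellation between the two kinds comes from this relation.\<close>

lemma b_period: "g \<in> \<Gamma> \<Longrightarrow> b g \<in> ZZ 1"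
  and b_eq: "g \<in> \<Gamma> \<Longrightarrow> z \<in> UH \<Longrightarrow> b g = lt g (f z) - l g z - lf (mob g z) + lf z"
proof -
  assume g: "g \<in> \<Gamma>"
  let ?k = "\<lambda>z. lt g (f z) - l g z - lf (mob g z) + lf z"
  have "continuous_on UH (\<lambda>z. lt g (f z))"
    using holomorphic_f_smooth[OF lt_holomorphic[OF g]] by (metis smooth_on_def Ck_on.simps(1))
  moreover have "continuous_on UH (\<lambda>z. lf (mob g z))"
    using lf mob_UH[OF g] holomorphic_on_imp_continuous_on[OF mob_holomorphic_UH[OF g]]
    by (auto simp: log_branch_def intro: continuous_on_compose2)
  ultimately have cont: "continuous_on UH ?k"
    using l[OF g] lf by (auto simp: log_branch_def intro!: continuous_intros)
  have exp1: "exp (?k z) = 1" if z: "z \<in> UH" for z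
  proof -
    have "exp (lt g (f z)) * exp (lf z) = exp (l g z) * exp (lf (mob g z))"
      using f_mob_wirt(1)[OF g z] l[OF g] lt[OF g] lf z mob_UH[OF g z] f_image[OF z]
      by (simp add: log_branch_def)
    then show ?thesis by (simp add: exp_add exp_diff)
  qed
  obtain a where a: "a \<in> ZZ 1" "\<And>z. z \<in> UH \<Longrightarrow> ?k z = a"
    using exp_eq_1_constant_period[OF connected_UH UH_nonempty cont exp1] by blast
  have "b g = a"
    unfolding b_const_def using a(2) UH_nonempty by (intro the_equality) auto
  with a show "b g \<in> ZZ 1" "z \<in> UH \<Longrightarrow> b g = ?k z" by auto
qed

end

section \<open>The descent identities\<close>

locale tame_trivialized = equivariant_map +
  fixes h :: "complex \<Rightarrow> complex" and \<tau> \<tau>t \<phi> \<phi>t :: "psl list \<Rightarrow> complex \<Rightarrow> complex"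
    and n nt :: "psl list \<Rightarrow> complex"
  assumes h: "quadratic_differential \<Gamma> h"
    and tame: "tame_trivialization \<Gamma> mob UH l \<tau> \<phi> n"
    and tame_tilde: "tame_trivialization \<Gamma> (\<lambda>\<gamma>. mob (tilde \<gamma>)) \<D> lt \<tau>t \<phi>t nt"
begin

lemma tau_holomorphic: "g \<in> \<Gamma> \<Longrightarrow> \<tau> [g] holomorphic_on UH"
  and taut_holomorphic: "g \<in> \<Gamma> \<Longrightarrow> \<tau>t [g] holomorphic_on \<D>"
  and phi_holomorphic: "g \<in> \<Gamma> \<Longrightarrow> g' \<in> \<Gamma> \<Longrightarrow> \<phi> [g, g'] holomorphic_on UH"
  and phit_holomorphic: "g \<in> \<Gamma> \<Longrightarrow> g' \<in> \<Gamma> \<Longrightarrow> \<phi>t [g, g'] holomorphic_on \<D>"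
  using tame tame_tilde by (simp_all add: tame_trivialization_def)

lemma n_period: "g1 \<in> \<Gamma> \<Longrightarrow> g2 \<in> \<Gamma> \<Longrightarrow> g3 \<in> \<Gamma> \<Longrightarrow> n [g1, g2, g3] \<in> ZZ 2"
  and nt_period: "g1 \<in> \<Gamma> \<Longrightarrow> g2 \<in> \<Gamma> \<Longrightarrow> g3 \<in> \<Gamma> \<Longrightarrow> nt [g1, g2, g3] \<in> ZZ 2"
  using tame tame_tilde by (simp_all add: tame_trivialization_def)

text \<open>The trivialization relations as identities between functions. On \<open>\<D>\<close> the points are written
  \<open>f z\<close> and the action is transported to \<open>UH\<close> by equivariance.\<close>

lemma tame_phi:
  assumes "g1 \<in> \<Gamma>" "g2 \<in> \<Gamma>" "g3 \<in> \<Gamma>" "z \<in> UH"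
  shows "\<phi> [g2, g3] z - \<phi> [g1 \<cdot> g2, g3] z + \<phi> [g1, g2 \<cdot> g3] z - \<phi> [g1, g2] (mob g3 z)
    = n [g1, g2, g3] - c g1 g2 * l g3 z"
  using tame assms by (simp add: tame_trivialization_def form_eq_def cobd_3 fn_form_def pullback_def algebra_simps)

lemma tame_phit:
  assumes "g1 \<in> \<Gamma>" "g2 \<in> \<Gamma>" "g3 \<in> \<Gamma>" "z \<in> UH"
  shows "\<phi>t [g2, g3] (f z) - \<phi>t [g1 \<cdot> g2, g3] (f z) + \<phi>t [g1, g2 \<cdot> g3] (f z) - \<phi>t [g1, g2] (f (mob g3 z))
    = nt [g1, g2, g3] - ct g1 g2 * lt g3 (f z)"
  using tame_tilde assms f_image[OF assms(4)] mob_f[OF assms(3,4)]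
  by (simp add: tame_trivialization_def form_eq_def cobd_3 fn_form_def pullback_def algebra_simps)

lemma tame_tau:
  assumes g: "g1 \<in> \<Gamma>" "g2 \<in> \<Gamma>" and z: "z \<in> UH"
  shows "- l g1 (mob g2 z) * deriv (l g2) z =
    \<tau> [g2] z - \<tau> [g1 \<cdot> g2] z + \<tau> [g1] (mob g2 z) * deriv (mob g2) z + deriv (\<phi> [g1, g2]) z"
proof -
  have "- l g1 (mob g2 z) * ext_d (fn_form (l g2)) z [1] =
      cobd mob (\<lambda>gs. dz_form (\<tau> gs)) [g1, g2] z [1] + ext_d (fn_form (\<phi> [g1, g2])) z [1]"
    using tame g z by (auto simp: tame_trivialization_def form_eq_def)
  then show ?thesis
    using g z
    by (simp add: ext_d_fn_form cobd_2 pullback_def dz_form_def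
        holomorphic_frechet[OF open_UH] mob_holomorphic_UH l_holomorphic phi_holomorphic)
qed

lemma tame_taut:
  assumes g: "g1 \<in> \<Gamma>" "g2 \<in> \<Gamma>" and z: "z \<in> UH"
  shows "- lt g1 (f (mob g2 z)) * deriv (lt g2) (f z) =
    \<tau>t [g2] (f z) - \<tau>t [g1 \<cdot> g2] (f z) + \<tau>t [g1] (f (mob g2 z)) * deriv (mob (tilde g2)) (f z)
    + deriv (\<phi>t [g1, g2]) (f z)"
proof -
  have "- lt g1 (mob (tilde g2) (f z)) * ext_d (fn_form (lt g2)) (f z) [1] =
      cobd (\<lambda>\<gamma>. mob (tilde \<gamma>)) (\<lambda>gs. dz_form (\<tau>t gs)) [g1, g2] (f z) [1] + ext_d (fn_form (\<phi>t [g1, g2])) (f z) [1]"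
    using tame_tilde g f_image[OF z] by (auto simp: tame_trivialization_def form_eq_def)
  then show ?thesis
    using g z f_image[OF z]
    by (simp add: ext_d_fn_form cobd_2 pullback_def dz_form_def mob_f
        holomorphic_frechet[OF open_image] mob_tilde_holomorphic lt_holomorphic phit_holomorphic)
qed

definition Theta where
  "Theta g1 g2 z = \<phi>t [g1, g2] (f z) - \<phi> [g1, g2] z - (ct g1 g2 + c g1 g2) * lf z
     - l g1 (mob g2 z) * lt g2 (f z) + ct g1 g2 * l (g1 \<cdot> g2) z"

abbreviation "m \<equiv> m_const c ct b n nt"

text \<open>Applying \<open>\<delta>\<close> to the terms \<open>\<phi>t \<circ> f - \<phi>\<close> gives \<open>nt - n - ct (lt \<circ> f) + c l\<close>. The terms with \<open>lf\<close> are
  the cocycle \<open>ct + c\<close> times \<open>lf\<close>, so only \<open>lf - lf \<circ> \<gamma>\<^sub>3\<close> survives, and \<open>b_eq\<close> turns it into logarithms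
  of derivatives. What remains cancels against the two product terms up to constants.\<close>

lemma delta_Theta:
  assumes g: "g1 \<in> \<Gamma>" "g2 \<in> \<Gamma>" "g3 \<in> \<Gamma>" and z: "z \<in> UH"
  shows "Theta g2 g3 z - Theta (g1 \<cdot> g2) g3 z + Theta g1 (g2 \<cdot> g3) z - Theta g1 g2 (mob g3 z) = m g1 g2 g3"
proof -
  note g12 = mult_closed[OF g(1,2)] and g23 = mult_closed[OF g(2,3)] and w = mob_UH[OF g(3) z]
    and comp = mob_comp[OF g(2,3) z]
  have assoc: "(g1 \<cdot> g2) \<cdot> g3 = g1 \<cdot> (g2 \<cdot> g3)" by (rule PSL2C_assoc)
  \<comment> \<open>The constants \<open>c\<close> and \<open>ct\<close> may be evaluated at any point; for the pair \<open>g1, g2\<close> the point is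
    \<open>mob g3 z\<close>, so that the same values of the logarithms occur throughout.\<close>
  note c = c_eq[OF g(2,3) z] c_eq[OF g(1,2) w] c_eq[OF g12 g(3) z, unfolded assoc]
      c_eq[OF g(1) g23 z, unfolded comp]
    and ct = ct_eq[OF g(2,3) z] ct_eq[OF g(1,2) w] ct_eq[OF g12 g(3) z, unfolded assoc]
      ct_eq[OF g(1) g23 z, unfolded comp]
  have b: "lf (mob g3 z) = lt g3 (f z) - l g3 z + lf z - b g3"
    using b_eq[OF g(3) z] by (simp add: algebra_simps)
  have n: "n [g1, g2, g3] = \<phi> [g2, g3] z - \<phi> [g1 \<cdot> g2, g3] z + \<phi> [g1, g2 \<cdot> g3] z
      - \<phi> [g1, g2] (mob g3 z) + c g1 g2 * l g3 z"
    using tame_phi[OF g z] by (simp add: algebra_simps)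
  have nt: "nt [g1, g2, g3] = \<phi>t [g2, g3] (f z) - \<phi>t [g1 \<cdot> g2, g3] (f z) + \<phi>t [g1, g2 \<cdot> g3] (f z)
      - \<phi>t [g1, g2] (f (mob g3 z)) + ct g1 g2 * lt g3 (f z)"
    using tame_phit[OF g z] by (simp add: algebra_simps)
  show ?thesis
    unfolding Theta_def m_const_def n nt assoc c ct b mob_comp[OF g(2,3) z]
    by (simp add: algebra_simps)
qed

text \<open>Since \<open>m = \<delta> \<Theta>\<close>, this is \<open>\<delta> \<delta> \<Theta> = 0\<close> evaluated at one point.\<close>

lemma delta_m:
  assumes g: "g1 \<in> \<Gamma>" "g2 \<in> \<Gamma>" "g3 \<in> \<Gamma>" "g4 \<in> \<Gamma>"
  shows "m g2 g3 g4 - m (g1 \<cdot> g2) g3 g4 + m g1 (g2 \<cdot> g3) g4 - m g1 g2 (g3 \<cdot> g4) + m g1 g2 g3 = 0"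
proof -
  obtain z where z: "z \<in> UH" using UH_nonempty by blast
  have m: "m g2 g3 g4 = Theta g3 g4 z - Theta (g2 \<cdot> g3) g4 z + Theta g2 (g3 \<cdot> g4) z - Theta g2 g3 (mob g4 z)"
    "m (g1 \<cdot> g2) g3 g4 = Theta g3 g4 z - Theta (g1 \<cdot> (g2 \<cdot> g3)) g4 z + Theta (g1 \<cdot> g2) (g3 \<cdot> g4) z - Theta (g1 \<cdot> g2) g3 (mob g4 z)"
    "m g1 (g2 \<cdot> g3) g4 = Theta (g2 \<cdot> g3) g4 z - Theta (g1 \<cdot> (g2 \<cdot> g3)) g4 z + Theta g1 (g2 \<cdot> (g3 \<cdot> g4)) z - Theta g1 (g2 \<cdot> g3) (mob g4 z)"
    "m g1 g2 (g3 \<cdot> g4) = Theta g2 (g3 \<cdot> g4) z - Theta (g1 \<cdot> g2) (g3 \<cdot> g4) z + Theta g1 (g2 \<cdot> (g3 \<cdot> g4)) z - Theta g1 g2 (mob g3 (mob g4 z))"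
    "m g1 g2 g3 = Theta g2 g3 (mob g4 z) - Theta (g1 \<cdot> g2) g3 (mob g4 z) + Theta g1 (g2 \<cdot> g3) (mob g4 z) - Theta g1 g2 (mob g3 (mob g4 z))"
    using delta_Theta[OF g(2-4) z] delta_Theta[OF mult_closed[OF g(1,2)] g(3,4) z]
      delta_Theta[OF g(1) mult_closed[OF g(2,3)] g(4) z] delta_Theta[OF g(1,2) mult_closed[OF g(3,4)] z]
      delta_Theta[OF g(1-3) mob_UH[OF g(4) z]] mob_comp[OF g(3,4) z]
    by (simp_all add: PSL2C_assoc)
  show ?thesis unfolding m by simp
qed

text \<open>The derivative of the constant \<open>b\<close> is zero. These two identities eliminate \<open>lt\<close> from the
  derivatives of \<open>\<theta>\<close> and \<open>\<Theta>\<close>.\<close>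

lemma lt_f_wirt:
  assumes g: "g \<in> \<Gamma>" and z: "z \<in> UH"
  shows "deriv (lt g) (f z) * wirt f z = deriv (l g) z + wirt lf (mob g z) * deriv (mob g) z - wirt lf z"
    and "deriv (lt g) (f z) * wirtbar f z = wirtbar lf (mob g z) * cnj (deriv (mob g) z) - wirtbar lf z"
proof -
  have "has_wirt (\<lambda>x. l g x + lf (mob g x) - lf x + b g)
      (deriv (l g) z + wirt lf (mob g z) * deriv (mob g) z - wirt lf z + 0)
      (0 + wirtbar lf (mob g z) * cnj (deriv (mob g) z) - wirtbar lf z + 0) z"
    by (intro has_wirt_intros l_has_wirt[OF g z] lf_has_wirt[OF z]
        has_wirt_comp_holomorphic[OF mob_has_deriv[OF g z] lf_has_wirt[OF mob_UH[OF g z]]])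
  then have "has_wirt (\<lambda>x. lt g (f x))
      (deriv (l g) z + wirt lf (mob g z) * deriv (mob g) z - wirt lf z + 0)
      (0 + wirtbar lf (mob g z) * cnj (deriv (mob g) z) - wirtbar lf z + 0) z"
    by (rule has_wirt_cong[OF open_UH z, rotated]) (simp add: b_eq[OF g])
  from has_wirt_unique[OF holomorphic_f_has_wirt[OF lt_holomorphic[OF g] z] this]
  show "deriv (lt g) (f z) * wirt f z = deriv (l g) z + wirt lf (mob g z) * deriv (mob g) z - wirt lf z"
    "deriv (lt g) (f z) * wirtbar f z = wirtbar lf (mob g z) * cnj (deriv (mob g) z) - wirtbar lf z" by auto
qed

lemma l_comp_has_wirt:
  assumes "g1 \<in> \<Gamma>" "g2 \<in> \<Gamma>" "z \<in> UH"
  shows "has_wirt (\<lambda>x. l g1 (mob g2 x)) (deriv (l g1) (mob g2 z) * deriv (mob g2) z) 0 z"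
  using has_wirt_comp_holomorphic[OF mob_has_deriv[OF assms(2,3)] l_has_wirt[OF assms(1) mob_UH[OF assms(2,3)]]]
  by simp

lemma deriv_l_cocycle:
  assumes g: "g1 \<in> \<Gamma>" "g2 \<in> \<Gamma>" and z: "z \<in> UH"
  shows "deriv (l (g1 \<cdot> g2)) z = deriv (l g2) z + deriv (l g1) (mob g2 z) * deriv (mob g2) z"
proof -
  have "has_wirt (\<lambda>x. l g2 x + l g1 (mob g2 x) - c g1 g2)
      (deriv (l g2) z + deriv (l g1) (mob g2 z) * deriv (mob g2) z - 0) (0 + 0 - 0) z"
    by (intro has_wirt_intros l_has_wirt l_comp_has_wirt g z)
  then have "has_wirt (l (g1 \<cdot> g2))
      (deriv (l g2) z + deriv (l g1) (mob g2 z) * deriv (mob g2) z - 0) (0 + 0 - 0) z"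
    by (rule has_wirt_cong[OF open_UH z, rotated]) (simp add: c_eq[OF g])
  from has_wirt_unique[OF l_has_wirt[OF mult_closed[OF g] z] this] show ?thesis by simp
qed

lemma mu_mob:
  assumes g: "g \<in> \<Gamma>" and z: "z \<in> UH"
  shows "\<mu> (mob g z) * cnj (deriv (mob g) z) = \<mu> z * deriv (mob g) z"
proof -
  have "\<mu> (mob g z) * cnj (deriv (mob g) z) / deriv (mob g) z = \<mu> z"
    using beltrami g z unfolding beltrami_differential_def by blast
  then show ?thesis using mob_deriv_nonzero_UH[OF g z] by (simp add: divide_eq_eq)
qed

abbreviation "\<theta> \<equiv> theta_form \<mu> f l lt lf \<tau> \<tau>t"

text \<open>The coefficients of \<open>\<theta>\<close> with respect to \<open>dz\<close> and its conjugate, with \<open>\<gamma>'' / \<gamma>'\<close> written as the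
  derivative of \<open>log \<gamma>'\<close>.\<close>

definition theta_dz where
  "theta_dz g z = lt g (f z) * deriv (l g) z - (lt g (f z) + l g z) * wirt lf z - \<tau>t [g] (f z) * wirt f z + \<tau> [g] z"

definition theta_dzbar where
  "theta_dzbar g z = 2 * \<mu> z * deriv (l g) z - (lt g (f z) + l g z) * wirtbar lf z - \<tau>t [g] (f z) * wirtbar f z"

lemma l_schwarzian:
  assumes g: "g \<in> \<Gamma>" and z: "z \<in> UH"
  shows "deriv (l g) z = deriv (deriv (mob g)) z / deriv (mob g) z"
    and "(deriv (l g) has_field_derivative (deriv (l g) z)\<^sup>2 / 2) (at z)"
  using mob_schwarzian[OF carrier[OF g] open_UH finite_UH[OF g] l[OF g] z] by auto

lemma theta_components:
  assumes g: "g \<in> \<Gamma>" and z: "z \<in> UH"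
  shows "\<theta> g z [v] = theta_dz g z * v + theta_dzbar g z * cnj v"
  using l_schwarzian(1)[OF g z] has_wirt_frechet[OF f_has_wirt[OF z]] has_wirt_frechet[OF lf_has_wirt[OF z]]
    has_wirt_frechet[OF l_has_wirt[OF g z]]
  by (simp add: theta_form_def theta_dz_def theta_dzbar_def dzbar_def ext_d_fn_form pullback_def dz_form_def algebra_simps)

text \<open>This is \<open>d \<Theta> = \<delta> \<theta>\<close>, one Wirtinger component at a time. The terms with \<open>\<mu>\<close> in \<open>\<delta> \<theta>\<close> add up to
  \<open>2 \<mu>\<close> times the derivative of the constant \<open>c\<close>, by the transformation law of \<open>\<mu>\<close>, and vanish. The
  terms with \<open>\<tau>\<close>, \<open>\<tau>t\<close>, \<open>\<phi>\<close>, \<open>\<phi>t\<close> are traded for logarithms by the trivialization, and the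
  remaining logarithmic terms match after \<open>lt_f_wirt\<close>.\<close>

lemma d_Theta:
  assumes g: "g1 \<in> \<Gamma>" "g2 \<in> \<Gamma>" and z: "z \<in> UH"
  shows "has_wirt (Theta g1 g2)
    (theta_dz g2 z - theta_dz (g1 \<cdot> g2) z + theta_dz g1 (mob g2 z) * deriv (mob g2) z)
    (theta_dzbar g2 z - theta_dzbar (g1 \<cdot> g2) z + theta_dzbar g1 (mob g2 z) * cnj (deriv (mob g2) z)) z"
proof -
  note g12 = mult_closed[OF g]
  have \<phi>: "has_wirt (\<phi> [g1, g2]) (deriv (\<phi> [g1, g2]) z) 0 z"
    using holomorphic_derivI[OF phi_holomorphic[OF g] open_UH z] by (simp add: has_wirt_holomorphic_iff)
  note Theta = has_wirt_add[OF has_wirt_diff[OF has_wirt_diff[OF has_wirt_diff[OF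
      holomorphic_f_has_wirt[OF phit_holomorphic[OF g] z] \<phi>]
      has_wirt_mult[OF has_wirt_const[of "ct g1 g2 + c g1 g2"] lf_has_wirt[OF z]]]
      has_wirt_mult[OF l_comp_has_wirt[OF g z] holomorphic_f_has_wirt[OF lt_holomorphic[OF g(2)] z]]]
      has_wirt_mult[OF has_wirt_const[of "ct g1 g2"] l_has_wirt[OF g12 z]], folded Theta_def]
  let ?g' = "deriv (mob g2) z" and ?w = "mob g2 z"
  have phi: "deriv (\<phi> [g1, g2]) z =
      - l g1 ?w * deriv (l g2) z - \<tau> [g2] z + \<tau> [g1 \<cdot> g2] z - \<tau> [g1] ?w * ?g'"
    using tame_tau[OF g z] by (simp add: algebra_simps)
  have phit: "deriv (\<phi>t [g1, g2]) (f z) = - lt g1 (f ?w) * deriv (lt g2) (f z)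
      - \<tau>t [g2] (f z) + \<tau>t [g1 \<cdot> g2] (f z) - \<tau>t [g1] (f ?w) * deriv (mob (tilde g2)) (f z)"
    using tame_taut[OF g z] by (simp add: algebra_simps)
  \<comment> \<open>The derivatives of \<open>lt g2 \<circ> f\<close> and of \<open>f \<circ> mob g2\<close> occur inside products; they are put
    together first, because the identities \<open>E\<close> and \<open>F\<close> rewrite whole products only.\<close>
  note E = lt_f_wirt[OF g(2) z] and F = f_mob_wirt[OF g(2) z]
  have phit_z: "deriv (\<phi>t [g1, g2]) (f z) * wirt f z =
      - lt g1 (f ?w) * (deriv (l g2) z + wirt lf ?w * ?g' - wirt lf z)
      - \<tau>t [g2] (f z) * wirt f z + \<tau>t [g1 \<cdot> g2] (f z) * wirt f z - \<tau>t [g1] (f ?w) * (wirt f ?w * ?g')"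
    unfolding phit E[symmetric] F[symmetric] by (simp add: algebra_simps)
  have phit_zbar: "deriv (\<phi>t [g1, g2]) (f z) * wirtbar f z =
      - lt g1 (f ?w) * (wirtbar lf ?w * cnj ?g' - wirtbar lf z)
      - \<tau>t [g2] (f z) * wirtbar f z + \<tau>t [g1 \<cdot> g2] (f z) * wirtbar f z
      - \<tau>t [g1] (f ?w) * (wirtbar f ?w * cnj ?g')"
    unfolding phit E[symmetric] F[symmetric] by (simp add: algebra_simps)
  have "theta_dzbar g1 ?w * cnj ?g' = 2 * (\<mu> ?w * cnj ?g') * deriv (l g1) ?w
      - (lt g1 (f ?w) + l g1 ?w) * (wirtbar lf ?w * cnj ?g') - \<tau>t [g1] (f ?w) * (wirtbar f ?w * cnj ?g')"
    unfolding theta_dzbar_def by (simp add: algebra_simps)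
  note theta_w = this[unfolded mu_mob[OF g(2) z]]
  note facts = deriv_l_cocycle[OF g z] c_eq[OF g z] ct_eq[OF g z]
  \<comment> \<open>The differentiation rules leave unreduced coefficients in \<open>Theta\<close>; each is compared with
    the corresponding component of \<open>\<delta> \<theta>\<close>.\<close>
  show ?thesis
  proof (rule back_subst[of "\<lambda>p. has_wirt _ p _ z", OF back_subst[of "\<lambda>q. has_wirt _ _ q z", OF Theta]])
    show "deriv (\<phi>t [g1, g2]) (f z) * wirtbar f z - 0 - (0 * lf z + (ct g1 g2 + c g1 g2) * wirtbar lf z)
        - (0 * lt g2 (f z) + l g1 ?w * (deriv (lt g2) (f z) * wirtbar f z)) + (0 * l (g1 \<cdot> g2) z + ct g1 g2 * 0)
      = theta_dzbar g2 z - theta_dzbar (g1 \<cdot> g2) z + theta_dzbar g1 ?w * cnj ?g'"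
      unfolding phit_zbar theta_w E facts unfolding theta_dzbar_def facts by (simp add: algebra_simps)
    show "deriv (\<phi>t [g1, g2]) (f z) * wirt f z - deriv (\<phi> [g1, g2]) z
        - (0 * lf z + (ct g1 g2 + c g1 g2) * wirt lf z)
        - (deriv (l g1) ?w * ?g' * lt g2 (f z) + l g1 ?w * (deriv (lt g2) (f z) * wirt f z))
        + (0 * l (g1 \<cdot> g2) z + ct g1 g2 * deriv (l (g1 \<cdot> g2)) z)
      = theta_dz g2 z - theta_dz (g1 \<cdot> g2) z + theta_dz g1 ?w * ?g'"
      unfolding phit_z phi E facts unfolding theta_dz_def facts by (simp add: algebra_simps)
  qed
qed

text \<open>Differentiating the Beltrami equation \<open>wirtbar f = \<mu> * wirt f\<close> and exchanging the two Wirtinger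
  derivatives of \<open>f\<close> gives \<open>\<partial> \<mu>\<close> in terms of \<open>lf\<close> and \<open>\<mu>\<close>.\<close>

lemma wirt_lf:
  assumes z: "z \<in> UH" shows "wirt lf z = wirt (wirt f) z / wirt f z"
    and "wirtbar lf z = wirt \<mu> z + \<mu> z * wirt lf z"
proof -
  note fz = smooth_on_has_wirt[OF open_UH smooth_on_wirt[OF f_smooth] z]
    and mu = smooth_on_has_wirt[OF open_UH mu_smooth z]
  note u = log_branch_has_wirt[OF open_UH z lf fz]
  show wirt: "wirt lf z = wirt (wirt f) z / wirt f z" using has_wirt_imp_wirt[OF u] .
  have "has_wirt (wirtbar f) (wirt \<mu> z * wirt f z + \<mu> z * wirt (wirt f) z)
      (wirtbar \<mu> z * wirt f z + \<mu> z * wirtbar (wirt f) z) z"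
    by (rule has_wirt_cong[OF open_UH z _ has_wirt_mult[OF mu fz]]) (simp add: f_beltrami)
  note wirtbar_wirt_commute[OF open_UH z f_has_wirt fz this]
  with has_wirt_imp_wirtbar[OF u] wirt_f_nonzero[OF z]
  show "wirtbar lf z = wirt \<mu> z + \<mu> z * wirt lf z"
    unfolding wirt by (simp add: field_simps)
qed

text \<open>The transformation law of \<open>\<partial> \<mu>\<close>, obtained by applying \<open>\<partial>\<close> to \<open>mu_mob\<close>, in which the
  antiholomorphic factor is a constant for \<open>\<partial>\<close>.\<close>

lemma wirt_mu_mob:
  assumes g: "g \<in> \<Gamma>" and z: "z \<in> UH"
  shows "wirt \<mu> (mob g z) * cnj (deriv (mob g) z) = wirt \<mu> z + \<mu> z * deriv (l g) z"
proof -
  let ?g' = "deriv (mob g)"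
  have g': "has_wirt ?g' (deriv ?g' z) 0 z"
    using holomorphic_derivI[OF holomorphic_deriv[OF mob_holomorphic_UH[OF g] open_UH] open_UH z]
    by (simp add: has_wirt_holomorphic_iff)
  then have cnj_g': "has_wirt (\<lambda>x. cnj (?g' x)) 0 (cnj (deriv ?g' z)) z"
    unfolding has_wirt_def by (auto dest: has_derivative_cnj)
  note lhs = has_wirt_mult[OF has_wirt_comp_holomorphic[OF mob_has_deriv[OF g z]
        smooth_on_has_wirt[OF open_UH mu_smooth mob_UH[OF g z]]] cnj_g']
  note rhs = has_wirt_mult[OF smooth_on_has_wirt[OF open_UH mu_smooth z] g']
  have "has_wirt (\<lambda>x. \<mu> x * ?g' x) (wirt \<mu> (mob g z) * ?g' z * cnj (?g' z) + \<mu> (mob g z) * 0)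
    (wirtbar \<mu> (mob g z) * cnj (?g' z) * cnj (?g' z) + \<mu> (mob g z) * cnj (deriv ?g' z)) z"
    by (rule has_wirt_cong[OF open_UH z _ lhs]) (rule mu_mob[OF g])
  from has_wirt_unique[OF this rhs]
  have "wirt \<mu> (mob g z) * ?g' z * cnj (?g' z) = wirt \<mu> z * ?g' z + \<mu> z * deriv ?g' z" by simp
  also have "deriv ?g' z = ?g' z * deriv (l g) z"
    using mob_deriv_nonzero_UH[OF g z] l_schwarzian(1)[OF g z] by simp
  finally have "?g' z * (wirt \<mu> (mob g z) * cnj (?g' z)) = ?g' z * (wirt \<mu> z + \<mu> z * deriv (l g) z)"
    by (simp add: algebra_simps)
  then show ?thesis using mob_deriv_nonzero_UH[OF g z] by simp
qed

text \<open>The coefficient of \<open>\<omega>\<close>, with \<open>\<partial>\<^sup>2 f / \<partial> f\<close> written as \<open>\<partial> log \<partial> f\<close>.\<close>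

definition omega_coeff where
  "omega_coeff z = wirt lf z * wirt \<mu> z + 2 * \<mu> z * h z"

abbreviation "\<omega> \<equiv> omega_form \<mu> f h"

lemma omega_component:
  "z \<in> UH \<Longrightarrow> \<omega> z [v, w] = omega_coeff z * (v * cnj w - w * cnj v)"
  by (simp add: omega_form_def omega_coeff_def dz_wedge_dzbar_def wirt_lf(1) algebra_simps)

text \<open>This is \<open>d \<theta> = \<omega> - \<gamma>\<^sup>* \<omega>\<close>. The contributions of \<open>\<tau>\<close> and of the pull-back of \<open>\<tau>t\<close> are closed. Writing
  \<open>u = lf\<close>, \<open>U = lf \<circ> \<gamma>\<close> and \<open>L = l \<gamma>\<close>, the other logarithmic terms contribute
  \<open>- dL \<and> du - dU \<and> du - dL \<and> dU\<close> by \<open>lt_f_wirt\<close>. Expressing the conjugate derivatives of \<open>u\<close> and \<open>U\<close> by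
  \<open>\<partial> \<mu>\<close> and \<open>\<mu>\<close>, and adding the differential of the summand with \<open>2 \<mu> L'\<close>, leaves \<open>\<omega> - \<gamma>\<^sup>* \<omega>\<close> plus
  \<open>2 \<mu> (L'' - L'\<^sup>2 / 2)\<close>, which is zero because \<open>\<gamma>\<close> has vanishing Schwarzian derivative. On the right
  the \<open>\<Gamma>\<close>-invariant summand \<open>2 \<mu> h\<close> of \<open>\<omega>\<close> drops out.\<close>

lemma d_theta:
  assumes g: "g \<in> \<Gamma>" and z: "z \<in> UH"
  obtains p1 p2 q1 q2 where "has_wirt (theta_dz g) p1 p2 z" "has_wirt (theta_dzbar g) q1 q2 z"
    "q1 - p2 = omega_coeff z - omega_coeff (mob g z) * (deriv (mob g) z * cnj (deriv (mob g) z))"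
proof -
  let ?w = "mob g z" and ?g' = "deriv (mob g) z" and ?l' = "deriv (l g) z"
  note M = holomorphic_f_has_wirt[OF lt_holomorphic[OF g] z]
    and T = holomorphic_f_has_wirt[OF taut_holomorphic[OF g] z]
    and L = l_has_wirt[OF g z]
    and mu = smooth_on_has_wirt[OF open_UH mu_smooth z]
    and fz = smooth_on_has_wirt[OF open_UH smooth_on_wirt[OF f_smooth] z]
    and fzbar = smooth_on_has_wirt[OF open_UH smooth_on_wirtbar[OF f_smooth] z]
    and uz = smooth_on_has_wirt[OF open_UH smooth_on_wirt[OF lf_smooth] z]
    and uzbar = smooth_on_has_wirt[OF open_UH smooth_on_wirtbar[OF lf_smooth] z]
  have tau: "has_wirt (\<tau> [g]) (deriv (\<tau> [g]) z) 0 z"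
    using holomorphic_derivI[OF tau_holomorphic[OF g] open_UH z] by (simp add: has_wirt_holomorphic_iff)
  have L': "has_wirt (deriv (l g)) (?l'\<^sup>2 / 2) 0 z"
    using l_schwarzian(2)[OF g z] by (simp add: has_wirt_holomorphic_iff)
  note P = has_wirt_add[OF has_wirt_diff[OF has_wirt_diff[OF has_wirt_mult[OF M L']
      has_wirt_mult[OF has_wirt_add[OF M L] uz]] has_wirt_mult[OF T fz]] tau, folded theta_dz_def]
  note Q = has_wirt_diff[OF has_wirt_diff[OF has_wirt_mult[OF has_wirt_mult[OF has_wirt_const[of 2] mu] L']
      has_wirt_mult[OF has_wirt_add[OF M L] uzbar]] has_wirt_mult[OF T fzbar], folded theta_dzbar_def]
  have f_sym: "wirtbar (wirt f) z = wirt (wirtbar f) z"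
    by (rule wirtbar_wirt_commute[OF open_UH z f_has_wirt fz fzbar])
  have u_sym: "wirtbar (wirt lf) z = wirt (wirtbar lf) z"
    by (rule wirtbar_wirt_commute[OF open_UH z lf_has_wirt uz uzbar])
  have h: "\<mu> ?w * h ?w * (?g' * cnj ?g') = \<mu> z * h z"
  proof -
    have "\<mu> ?w * h ?w * (?g' * cnj ?g') = (\<mu> ?w * cnj ?g') * (h ?w * ?g')" by (simp add: algebra_simps)
    also have "\<dots> = \<mu> z * (h ?w * ?g'\<^sup>2)"
      unfolding mu_mob[OF g z] by (simp add: power2_eq_square algebra_simps)
    also have "h ?w * ?g'\<^sup>2 = h z" using h g z unfolding quadratic_differential_def by blast
    finally show ?thesis .
  qed
  have "omega_coeff ?w * (?g' * cnj ?g') =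
      wirt lf ?w * ?g' * (wirt \<mu> ?w * cnj ?g') + 2 * (\<mu> ?w * h ?w * (?g' * cnj ?g'))"
    unfolding omega_coeff_def by (simp add: algebra_simps)
  note w = this[unfolded wirt_mu_mob[OF g z] h]
  have "wirtbar lf ?w * cnj ?g' = wirt \<mu> ?w * cnj ?g' + \<mu> ?w * cnj ?g' * wirt lf ?w"
    unfolding wirt_lf(2)[OF mob_UH[OF g z]] by (simp add: algebra_simps)
  note u_w = this[unfolded wirt_mu_mob[OF g z] mu_mob[OF g z]]
  have half: "2 * \<mu> z * (?l'\<^sup>2 / 2) = \<mu> z * ?l' * ?l'" by (simp add: power2_eq_square)
  show thesis
    by (rule that[OF P Q], unfold w lt_f_wirt[OF g z] u_w f_sym u_sym half, unfold omega_coeff_def wirt_lf(2)[OF z])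
      (simp add: algebra_simps)
qed

section \<open>The total cochain\<close>

abbreviation "\<Omega> \<equiv> Omega_cochain \<omega> \<theta> (Theta_form f l lt lf c ct \<phi> \<phi>t) m"
abbreviation "K \<equiv> 2 * of_real pi * \<i> :: complex"

lemma Theta_form_eq: "Theta_form f l lt lf c ct \<phi> \<phi>t g1 g2 z vs = Theta g1 g2 z"
  unfolding Theta_form_def Theta_def pullback_def fn_form_def ..

lemma Omega_3: "\<Omega> 3 gs z vs = K * \<omega> z vs"
  and Omega_2: "\<Omega> 2 gs z vs = K * \<theta> (gs ! 0) z vs"
  and Omega_1: "\<Omega> (Suc 0) gs z vs = - K * Theta (gs ! 0) (gs ! 1) z"
  and Omega_0: "\<Omega> 0 gs z vs = - K * m (gs ! 0) (gs ! 1) (gs ! 2)"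
  unfolding Omega_cochain_def Theta_form_eq by simp_all

lemma h_smooth: "smooth_on UH h"
  using h unfolding quadratic_differential_def by blast

text \<open>The terms of positive degree are smooth because all logarithms are. In degree zero the constants
  \<open>c\<close>, \<open>ct\<close>, \<open>b\<close> lie in \<open>\<int>(1)\<close>, hence \<open>m\<close> lies in \<open>\<int>(2)\<close>, and the factor \<open>2\<pi>\<i>\<close> moves it to \<open>\<int>(3)\<close>.\<close>

lemma Omega_smooth: "\<Omega> \<in> tot_cochains \<Gamma> 3"
  unfolding tot_cochains_def
proof (intro CollectI allI impI, elim conjE)
  fix p gs assume p: "p + length gs = 3" and gs: "gs \<in> lists \<Gamma>"
  note smooth = open_UH f_smooth lf_smooth mu_smooth h_smooth smooth_on_intros
  note hol_smooth = holomorphic_smooth_on[OF open_UH]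
  consider "p = 0" | "p = 1" | "p = 2" | "p = 3" using p by linarith
  then show "\<Omega> p gs \<in> deligne_term p"
  proof cases
    case 1
    then obtain g1 g2 g3 where gs3: "gs = [g1, g2, g3]" using p by (auto simp: numeral_3_eq_3 length_Suc_conv)
    then have g: "g1 \<in> \<Gamma>" "g2 \<in> \<Gamma>" "g3 \<in> \<Gamma>" using gs by auto
    have mul: "x \<in> ZZ 1 \<Longrightarrow> y \<in> ZZ 1 \<Longrightarrow> x * y \<in> ZZ 2" for x y using ZZ_mult[of x 1 y 1] by (simp add: numeral_2_eq_2)
    have "m g1 g2 g3 \<in> ZZ 2"
      unfolding m_const_def
      by (intro ZZ_add ZZ_diff mul n_period nt_period c_period ct_period b_period mult_closed g)
    then have "K * - m g1 g2 g3 \<in> ZZ 3"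
      using ZZ_mult[OF period_in_ZZ_1 ZZ_minus] by (simp add: numeral_eq_Suc)
    then show ?thesis
      unfolding 1 deligne_term_def form_eq_def fn_form_def Omega_0 gs3
      by (simp, intro bexI[of _ "K * - m g1 g2 g3"]) simp_all
  next
    case 2
    then obtain g1 g2 where gs2: "gs = [g1, g2]" using p by (auto simp: numeral_3_eq_3 length_Suc_conv)
    then have g: "g1 \<in> \<Gamma>" "g2 \<in> \<Gamma>" using gs by auto
    have "smooth_on UH (\<lambda>z. l g1 (mob g2 z))"
      by (rule smooth_on_holomorphic_comp[OF open_UH open_UH _ _ l_holomorphic[OF g(1)]])
        (use g in \<open>auto intro!: holomorphic_smooth_on[OF open_UH] mob_holomorphic_UH mob_UH\<close>)
    then have "smooth_on UH (\<lambda>z. - K * Theta g1 g2 z)"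
      unfolding Theta_def
      by (intro smooth hol_smooth[OF phi_holomorphic[OF g]] hol_smooth[OF l_holomorphic[OF mult_closed[OF g]]]
          holomorphic_f_smooth[OF phit_holomorphic[OF g]] holomorphic_f_smooth[OF lt_holomorphic[OF g(2)]])
    then show ?thesis
      unfolding 2 deligne_term_def by (simp add: smooth_zero_formI Omega_1 gs2)
  next
    case 3
    then obtain g where gs1: "gs = [g]" using p by (auto simp: numeral_3_eq_3 length_Suc_conv)
    then have g: "g \<in> \<Gamma>" using gs by auto
    have "smooth_on UH (\<lambda>z. K * theta_dz g z)" "smooth_on UH (\<lambda>z. K * theta_dzbar g z)"
      unfolding theta_dz_def theta_dzbar_def
      by (intro smooth hol_smooth[OF l_holomorphic[OF g]] hol_smooth[OF tau_holomorphic[OF g]]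
          hol_smooth[OF holomorphic_deriv[OF l_holomorphic[OF g] open_UH]]
          holomorphic_f_smooth[OF taut_holomorphic[OF g]] holomorphic_f_smooth[OF lt_holomorphic[OF g]])+
    then have "\<Omega> 2 gs \<in> smooth_forms UH 1"
      by (rule smooth_one_formI[OF open_UH]) (simp add: Omega_2 gs1 theta_components[OF g] algebra_simps)
    then show ?thesis unfolding 3 deligne_term_def by simp
  next
    case 4
    have "smooth_on UH (\<lambda>z. K * omega_coeff z)"
      unfolding omega_coeff_def by (intro smooth)
    then have "\<Omega> 3 gs \<in> smooth_forms UH 2"
      by (rule smooth_two_formI[OF open_UH]) (simp add: Omega_3 omega_component)
    then show ?thesis unfolding 4 deligne_term_def by simp
  qed
qed

text \<open>The component of \<open>D \<Omega>\<close> at \<open>p = 0, 1, 2, 3\<close> is, up to the factor \<open>2\<pi>\<i>\<close> and a sign, \<open>\<delta> m\<close>,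
  \<open>\<delta> \<Theta> - m\<close>, \<open>d \<Theta> - \<delta> \<theta>\<close>, \<open>d \<theta> - \<delta> \<omega>\<close>. At \<open>p = 4\<close> both the last differential of the complex and the
  coboundary into cochains without group arguments are zero.\<close>

lemma Omega_cocycle: "tot_eq \<Gamma> (3 + 1) (tot_D \<Omega>) tot_zero"
  unfolding tot_eq_def tot_zero_def zero_form_def form_eq_def
proof (intro allI impI ballI, elim conjE)
  fix p gs z and vs :: "complex list"
  assume p: "p + length gs = 3 + 1" and gs: "gs \<in> lists \<Gamma>" and z: "z \<in> UH" and vs: "length vs = p - 1"
  have pull: "pullback (mob g) \<alpha> z vs = \<alpha> (mob g z) (map ((*) (deriv (mob g) z)) vs)" if "g \<in> \<Gamma>" for g \<alpha>
    using holomorphic_frechet[OF open_UH mob_holomorphic_UH[OF that] z] by (simp add: pullback_def)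
  have "p \<le> 4" using p by simp
  then have "p = 0 \<or> p = 1 \<or> p = 2 \<or> p = 3 \<or> p = 4" by presburger
  then consider "p = 0" | "p = 1" | "p = 2" | "p = 3" | "p = 4" by blast
  then show "tot_D \<Omega> p gs z vs = 0"
  proof cases
    case 1
    then obtain g1 g2 g3 g4 where gs4: "gs = [g1, g2, g3, g4]" using p by (auto simp: length_Suc_conv eval_nat_numeral)
    then have g: "g1 \<in> \<Gamma>" "g2 \<in> \<Gamma>" "g3 \<in> \<Gamma>" "g4 \<in> \<Gamma>" using gs by auto
    have "tot_D \<Omega> 0 gs z vs = - K * (m g2 g3 g4 - m (g1 \<cdot> g2) g3 g4 + m g1 (g2 \<cdot> g3) g4 - m g1 g2 (g3 \<cdot> g4) + m g1 g2 g3)"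
      by (simp add: tot_D_def gs4 cobd_4 Omega_0 pull g algebra_simps)
    then show ?thesis unfolding 1 delta_m[OF g] by simp
  next
    case 2
    then obtain g1 g2 g3 where gs3: "gs = [g1, g2, g3]" using p by (auto simp: length_Suc_conv eval_nat_numeral)
    then have g: "g1 \<in> \<Gamma>" "g2 \<in> \<Gamma>" "g3 \<in> \<Gamma>" using gs by auto
    have "tot_D \<Omega> 1 gs z vs = - K * m g1 g2 g3
        + K * (Theta g2 g3 z - Theta (g1 \<cdot> g2) g3 z + Theta g1 (g2 \<cdot> g3) z - Theta g1 g2 (mob g3 z))"
      by (simp add: tot_D_def deligne_d_def gs3 cobd_3 Omega_0 Omega_1 pull g algebra_simps)
    then show ?thesis unfolding 2 delta_Theta[OF g z] by simp
  next
    case 3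
    then obtain g1 g2 where gs2: "gs = [g1, g2]" using p by (auto simp: length_Suc_conv eval_nat_numeral)
    then have g: "g1 \<in> \<Gamma>" "g2 \<in> \<Gamma>" using gs by auto
    obtain v where v: "vs = [v]" using vs 3 by (auto simp: length_1_conv)
    have "has_wirt (\<lambda>x. - K * Theta g1 g2 x)
        (0 * Theta g1 g2 z + - K * (theta_dz g2 z - theta_dz (g1 \<cdot> g2) z + theta_dz g1 (mob g2 z) * deriv (mob g2) z))
        (0 * Theta g1 g2 z + - K * (theta_dzbar g2 z - theta_dzbar (g1 \<cdot> g2) z + theta_dzbar g1 (mob g2 z) * cnj (deriv (mob g2) z))) z"
      by (rule has_wirt_mult[OF has_wirt_const d_Theta[OF g z]])
    from ext_d_function[OF open_UH z _ this, of "\<Omega> 1 gs" v]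
    have "ext_d (\<Omega> 1 gs) z [v] =
        - K * (theta_dz g2 z - theta_dz (g1 \<cdot> g2) z + theta_dz g1 (mob g2 z) * deriv (mob g2) z) * v
        - K * (theta_dzbar g2 z - theta_dzbar (g1 \<cdot> g2) z + theta_dzbar g1 (mob g2 z) * cnj (deriv (mob g2) z)) * cnj v"
      by (simp add: Omega_1 gs2)
    then show ?thesis
      unfolding 3 using pull[OF g(2)] g z
      by (simp add: tot_D_def deligne_d_def gs2 v cobd_2 Omega_2 theta_components mult_closed mob_UH algebra_simps)
  next
    case 4
    then obtain g where gs1: "gs = [g]" using p by (auto simp: length_Suc_conv eval_nat_numeral)
    then have g: "g \<in> \<Gamma>" using gs by auto
    obtain v w where vw: "vs = [v, w]" using vs 4 by (auto simp: numeral_2_eq_2 length_2_conv)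
    obtain p1 p2 q1 q2 where d: "has_wirt (theta_dz g) p1 p2 z" "has_wirt (theta_dzbar g) q1 q2 z"
      "q1 - p2 = omega_coeff z - omega_coeff (mob g z) * (deriv (mob g) z * cnj (deriv (mob g) z))"
      using d_theta[OF g z] .
    have "ext_d (\<Omega> 2 gs) z [v, w] = (0 * theta_dzbar g z + K * q1 - (0 * theta_dz g z + K * p2)) * (v * cnj w - w * cnj v)"
      by (rule ext_d_one_form[OF open_UH z _ has_wirt_mult[OF has_wirt_const[of K] d(1)] has_wirt_mult[OF has_wirt_const[of K] d(2)]])
        (simp add: Omega_2 gs1 theta_components[OF g] algebra_simps)
    also have "\<dots> = K * (q1 - p2) * (v * cnj w - w * cnj v)" by (simp add: algebra_simps)
    finally show ?thesis
      unfolding 4 d(3) using pull[OF g]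
      by (simp add: tot_D_def deligne_d_def gs1 vw cobd_1 Omega_3 omega_component mob_UH g z algebra_simps)
  next
    case 5
    then show ?thesis using p by (simp add: tot_D_def deligne_d_def zero_form_def cobd_def)
  qed
qed

end

theorem proposition3p4p1:
  fixes X :: "'x topology" and proj :: "complex \<Rightarrow> 'x" and genus :: nat
    and \<Gamma> \<Gamma>t :: "psl set" and tilde :: "psl \<Rightarrow> psl"
    and \<mu> f h :: "complex \<Rightarrow> complex" and \<D> :: "complex set"
    and l lt :: "psl \<Rightarrow> complex \<Rightarrow> complex" and lf :: "complex \<Rightarrow> complex"
    and \<tau> \<tau>t \<phi> \<phi>t :: "psl list \<Rightarrow> complex \<Rightarrow> complex"
    and n nt :: "psl list \<Rightarrow> complex"
    and c ct :: "psl \<Rightarrow> psl \<Rightarrow> complex" and b :: "psl \<Rightarrow> complex"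
    and \<Omega> :: tot_cochain
  assumes "fuchsian \<Gamma>" and "finitely_generated \<Gamma>" and "purely_hyperbolic \<Gamma>"
    and "is_quotient_by \<Gamma> X proj" and "compact_space X"
    and "has_genus X genus" and "genus > 1"
    and "PSL2C\<lparr>carrier := \<Gamma>\<rparr> \<cong> fundamental_group X (proj \<i>)"
    and "beltrami_differential \<Gamma> \<mu>"
    and "\<D> = f ` UH" and "diffeo_onto UH \<D> f" and "quasi_disk \<D>"
    and "\<And>z. z \<in> UH \<Longrightarrow> wirtbar f z = \<mu> z * wirt f z"
    and "tilde \<in> iso (PSL2C\<lparr>carrier := \<Gamma>\<rparr>) (PSL2C\<lparr>carrier := \<Gamma>t\<rparr>)"
    and "discrete_subgroup \<Gamma>t"
    and "\<And>\<gamma> z. \<gamma> \<in> \<Gamma> \<Longrightarrow> z \<in> UH \<Longrightarrow>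
           finite_at (tilde \<gamma>) (f z) \<and> mob (tilde \<gamma>) (f z) = f (mob \<gamma> z)"
    and "quadratic_differential \<Gamma> h"
    and "\<And>\<gamma>. \<gamma> \<in> \<Gamma> \<Longrightarrow> log_branch UH (deriv (mob \<gamma>)) (l \<gamma>)"
    and "\<And>\<gamma>. \<gamma> \<in> \<Gamma> \<Longrightarrow> log_branch \<D> (deriv (mob (tilde \<gamma>))) (lt \<gamma>)"
    and "log_branch UH (wirt f) lf"
    and "tame_trivialization \<Gamma> mob UH l \<tau> \<phi> n"
    and "tame_trivialization \<Gamma> (\<lambda>\<gamma>. mob (tilde \<gamma>)) \<D> lt \<tau>t \<phi>t nt"
    and "c = log_cocycle mob UH l"
    and "ct = log_cocycle (\<lambda>\<gamma>. mob (tilde \<gamma>)) \<D> lt"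
    and "b = b_const f l lt lf"
    and "\<Omega> = Omega_cochain (omega_form \<mu> f h) (theta_form \<mu> f l lt lf \<tau> \<tau>t)
               (Theta_form f l lt lf c ct \<phi> \<phi>t) (m_const c ct b n nt)"
  shows "\<Omega> \<in> deligne_cocycles \<Gamma> 3 \<and>
         deligne_coboundaries \<Gamma> 3 #>\<^bsub>deligne_cocycle_group \<Gamma> 3\<^esub> \<Omega>
           \<in> carrier (deligne_cohomology \<Gamma> 3)"
proof -
  have sub: "subgroup \<Gamma> PSL2C" "\<Gamma> \<subseteq> PSL2R"
    using assms(1) by (auto simp: fuchsian_def discrete_subgroup_def)
  have diffeo: "open \<D>" "smooth_on UH f"
    using assms(11) by (simp_all add: diffeo_onto_def)
  have tilde: "tilde \<gamma> \<in> carrier PSL2C" if "\<gamma> \<in> \<Gamma>" for \<gamma>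
  proof -
    have "tilde \<gamma> \<in> \<Gamma>t" using assms(14) that by (auto simp: iso_def hom_def)
    moreover have "\<Gamma>t \<subseteq> carrier PSL2C"
      using assms(15) by (simp add: discrete_subgroup_def subgroup.subset)
    ultimately show ?thesis by blast
  qed
  interpret tame_trivialized \<Gamma> tilde \<mu> f \<D> l lt lf h \<tau> \<tau>t \<phi> \<phi>t n nt
    by (intro tame_trivialized.intro equivariant_map.intro tame_trivialized_axioms.intro;
        fact sub diffeo tilde assms)
  have cocycle: "\<Omega> \<in> deligne_cocycles \<Gamma> 3"
    unfolding deligne_cocycles_def assms(26) unfolding assms(23-25)
    using Omega_smooth Omega_cocycle by blast
  then have "\<Omega> \<in> carrier (deligne_cocycle_group \<Gamma> 3)"
    by (simp add: deligne_cocycle_group_def)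
  then have "deligne_coboundaries \<Gamma> 3 #>\<^bsub>deligne_cocycle_group \<Gamma> 3\<^esub> \<Omega> \<in> carrier (deligne_cohomology \<Gamma> 3)"
    unfolding deligne_cohomology_def FactGroup_def RCOSETS_def by auto
  with cocycle show ?thesis ..
qed

end
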